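(* Let $\alpha>0$, let $W(t,\omega)$, $t>0$, be a Wiener process, let $w(t)=\frac{1}{t(1-t)}$ on $(0,1)$, and let $\tilde g\in L^2_w(0,1)$. Let $$\tilde b_n=\int_0^1\tilde\psi_n^{\alpha}(t)\,\tilde g(t)\,w(t)\,dt,\qquad \tilde B_n(\omega)=\int_0^1\tilde\psi_n^{\alpha}(s)\sqrt{w(s)}\,dW(s,\omega),\qquad n\in\mathbb{N}_0,$$ where $\tilde\psi_n^{\alpha}$ are the transformed Hermite functions, and let $\lambda_n=e^{-in\pi/2}$. Then for every $t\in(0,1)$ the series $$\sum_{n=0}^{\infty}\tilde b_n\tilde B_n(\omega)\frac{1}{\sqrt{\alpha}}\lambda_n\psi_n\!\left(\frac{\phi(t)}{\alpha}\right)$$ converges in quadratic mean (i.e. in $L^2(\Omega)$) to the stochastic integral $\int_0^1\mathcal{F}(\tilde g(s,t))\sqrt{w(s)}\,dW(s,\omega)$, where $$\mathcal{F}(\tilde g(s,t))=\sum_{k=0}^{\infty}\frac{1}{\sqrt{\alpha}}\tilde b_k\tilde\psi_k^{\alpha}(s)\lambda_k\psi_k\!\left(\frac{\phi(t)}{\alpha}\right)$$ (sum of the series in $L^2_w(0,1)$ in the variable $s$).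
   Context: $\mathbb{N}_0=\{0,1,2,\dots\}$. The Hermite polynomials are $H_n(t)=(-1)^n e^{t^2}\frac{d^n}{dt^n}e^{-t^2}$. The Hermite functions are $\psi_n(t)=\frac{1}{\sqrt{2^n n!\sqrt{\pi}}}H_n(t)e^{-t^2/2}$, $t\in\mathbb{R}$; for $\alpha>0$ the generalized Hermite functions are $\psi_n^{\alpha}(t)=\sqrt{\alpha}\,\psi_n(\alpha t)$. With $\phi(x)=\ln\frac{x}{1-x}$, $x\in(0,1)$, the transformed Hermite functions are $\tilde\psi_n^{\alpha}(x)=\psi_n^{\alpha}(\phi(x))$, $x\in(0,1)$. The weight is $w(x)=\phi'(x)=\frac{1}{x(1-x)}$, and $L^2_w(0,1)$ is the space of measurable $g$ on $(0,1)$ with $\int_0^1|g(x)|^2w(x)\,dx<\infty$. The symbol $\mathcal{F}(\tilde g(s,t))$ arises from $\tilde g(s,t)=\sum_k\tilde b_k\tilde\psi_k^{\alpha}(s)\tilde\psi_k^{\alpha}(t)$ by replacing $\tilde\psi_k^{\alpha}(t)$ with its Fourier transform, which in the paper's convention is $\mathcal{F}(\tilde\psi_k^{\alpha}(t))=\frac{1}{\sqrt{\alpha}}\lambda_k\psi_k(\phi(t)/\alpha)$. For $f\in L^2(0,1)$ the stochastic integral $\int_0^1 f(s)\,dW(s,\omega)$ is defined in quadratic mean (the Wiener integral), with $E\left|\int_0^1 f\,dW\right|^2=c^2\int_0^1|f(s)|^2ds$, where $c>0$ is the constant associated with the normal law of the increments of $W$; hence $\int_0^1 f(s)\sqrt{w(s)}\,dW(s,\omega)$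 is defined for $f\in L^2_w(0,1)$ (complex-valued $f$ by linearity). *)

theory Defs
  imports "HOL-Probability.Probability"
begin

definition hermite_poly :: "nat \<Rightarrow> real \<Rightarrow> real" where
  "hermite_poly n t = (-1) ^ n * exp (t\<^sup>2) * (deriv ^^ n) (\<lambda>u. exp (- u\<^sup>2)) t"

definition hermite_fun :: "nat \<Rightarrow> real \<Rightarrow> real" where
  "hermite_fun n t = 1 / sqrt (2 ^ n * fact n * sqrt pi) * hermite_poly n t * exp (- t\<^sup>2 / 2)"

definition gen_hermite_fun :: "real \<Rightarrow> nat \<Rightarrow> real \<Rightarrow> real" where
  "gen_hermite_fun \<alpha> n t = sqrt \<alpha> * hermite_fun n (\<alpha> * t)"

definition phi :: "real \<Rightarrow> real" where
  "phi x = ln (x / (1 - x))"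

definition trans_hermite_fun :: "real \<Rightarrow> nat \<Rightarrow> real \<Rightarrow> real" where
  "trans_hermite_fun \<alpha> n x = gen_hermite_fun \<alpha> n (phi x)"

definition weight :: "real \<Rightarrow> real" where
  "weight x = 1 / (x * (1 - x))"

lemma has_real_derivative_phi:
  assumes "0 < x" "x < 1"
  shows "(phi has_real_derivative weight x) (at x)"
proof -
  have "((\<lambda>x. x / (1 - x)) has_real_derivative 1 / (1 - x)\<^sup>2) (at x)"
    using assms by (auto intro!: derivative_eq_intros simp: power2_eq_square)
  moreover have "x / (1 - x) > 0"
    using assms by simp
  ultimately have "((\<lambda>x. ln (x / (1 - x))) has_real_derivative 1 / (x / (1 - x)) * (1 / (1 - x)\<^sup>2)) (at x)"
    by (rule DERIV_ln_divide[THEN DERIV_chain2, rotated])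
  moreover have "1 / (x / (1 - x)) * (1 / (1 - x)\<^sup>2) = weight x"
    using assms by (simp add: weight_def power2_eq_square)
  ultimately show ?thesis
    by (simp add: phi_def[abs_def])
qed

text \<open>Eigenvalues of the Fourier transform on the Hermite functions.\<close>

definition hermite_eigenvalue :: "nat \<Rightarrow> complex" where
  "hermite_eigenvalue n = exp (- (\<i> * of_nat n * of_real pi / 2))"

text \<open>The Fourier transform of \<^term>\<open>trans_hermite_fun \<alpha> n\<close>, evaluated at a point of (0,1).
  The convention is the one in which it is given by this closed form.\<close>

definition fourier_trans_hermite_fun :: "real \<Rightarrow> nat \<Rightarrow> real \<Rightarrow> complex" where
  "fourier_trans_hermite_fun \<alpha> n t =
     of_real (1 / sqrt \<alpha>) * hermite_eigenvalue n * of_real (hermite_fun n (phi t / \<alpha>))"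


definition square_integrable :: "'a measure \<Rightarrow> ('a \<Rightarrow> 'b::{banach, second_countable_topology}) \<Rightarrow> bool" where
  "square_integrable N f \<longleftrightarrow> f \<in> borel_measurable N \<and> integrable N (\<lambda>x. (norm (f x))\<^sup>2)"

text \<open>Convergence in the norm of \<open>L\<^sup>2(N)\<close>; if \<open>N\<close> is a probability space, this is convergence in
  quadratic mean. Limits are unique only up to null sets.\<close>

definition L2_tendsto ::
    "'a measure \<Rightarrow> (nat \<Rightarrow> 'a \<Rightarrow> 'b::{banach, second_countable_topology}) \<Rightarrow> ('a \<Rightarrow> 'b) \<Rightarrow> bool" where
  "L2_tendsto N X Y \<longleftrightarrow>
     (\<forall>n. square_integrable N (X n)) \<and> square_integrable N Y \<and>
     (\<lambda>n. LINT x|N. (norm (X n x - Y x))\<^sup>2) \<longlonglongrightarrow> 0"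

abbreviation lebesgue01 :: "real measure" where
  "lebesgue01 \<equiv> lebesgue_on {0<..<1}"

text \<open>The measure \<open>w(x) dx\<close> on (0,1), so that
  \<open>L\<^sup>2\<^sub>w(0,1)\<close> is \<open>L\<^sup>2\<close> of this measure.\<close>

definition weighted01 :: "real measure" where
  "weighted01 = density lebesgue01 (\<lambda>x. ennreal (weight x))"


locale wiener_process = prob_space M for M :: "'a measure" +
  fixes W :: "real \<Rightarrow> 'a \<Rightarrow> real" and c :: real
  assumes c_pos: "c > 0"
    and measurable_W: "\<And>t. t \<ge> 0 \<Longrightarrow> W t \<in> borel_measurable M"
    and W_0: "AE \<omega> in M. W 0 \<omega> = 0"
    and normal_increments: "\<And>s t. 0 \<le> s \<Longrightarrow> s < t \<Longrightarrow>
      distributed M lborel (\<lambda>\<omega>. W t \<omega> - W s \<omega>) (normal_density 0 (c * sqrt (t - s)))"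
    and indep_increments: "\<And>(n::nat) t. 0 \<le> t 0 \<Longrightarrow> (\<And>i. i < n \<Longrightarrow> t i < t (Suc i)) \<Longrightarrow>
      indep_vars (\<lambda>_. borel) (\<lambda>i \<omega>. W (t (Suc i)) \<omega> - W (t i) \<omega>) {..<n}"
    and continuous_paths: "AE \<omega> in M. continuous_on {0..} (\<lambda>t. W t \<omega>)"


text \<open>A list of triples \<open>(a, l, r)\<close> represents the step function
  \<open>\<Sum> a \<cdot> 1\<^bsub>(l, r]\<^esub>\<close>; the intervals may overlap.\<close>

type_synonym step_rep = "(real \<times> real \<times> real) list"

definition step_rep01 :: "step_rep \<Rightarrow> bool" where
  "step_rep01 p \<longleftrightarrow> (\<forall>(a, l, r) \<in> set p. 0 \<le> l \<and> l \<le> r \<and> r \<le> 1)"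

definition step_fun :: "step_rep \<Rightarrow> real \<Rightarrow> real" where
  "step_fun p s = (\<Sum>(a, l, r)\<leftarrow>p. a * indicator {l<..r} s)"

definition step_integral :: "(real \<Rightarrow> 'a \<Rightarrow> real) \<Rightarrow> step_rep \<Rightarrow> 'a \<Rightarrow> real" where
  "step_integral W p \<omega> = (\<Sum>(a, l, r)\<leftarrow>p. a * (W r \<omega> - W l \<omega>))"

definition has_wiener_integral ::
    "'a measure \<Rightarrow> (real \<Rightarrow> 'a \<Rightarrow> real) \<Rightarrow> (real \<Rightarrow> real) \<Rightarrow> ('a \<Rightarrow> real) \<Rightarrow> bool" where
  "has_wiener_integral M W f J \<longleftrightarrow>
     (\<exists>p. (\<forall>k. step_rep01 (p k)) \<and>
          L2_tendsto lebesgue01 (\<lambda>k. step_fun (p k)) f \<and>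
          L2_tendsto M (\<lambda>k. step_integral W (p k)) J)"

text \<open>For a Wiener process and \<open>f\<close> in \<open>L\<^sup>2(0,1)\<close> the integral exists and is unique up to a null
  set; a version is selected.\<close>

definition wiener_integral ::
    "'a measure \<Rightarrow> (real \<Rightarrow> 'a \<Rightarrow> real) \<Rightarrow> (real \<Rightarrow> real) \<Rightarrow> 'a \<Rightarrow> real" where
  "wiener_integral M W f = (SOME J. has_wiener_integral M W f J)"

definition cwiener_integral ::
    "'a measure \<Rightarrow> (real \<Rightarrow> 'a \<Rightarrow> real) \<Rightarrow> (real \<Rightarrow> complex) \<Rightarrow> 'a \<Rightarrow> complex" where
  "cwiener_integral M W f \<omega> =
     of_real (wiener_integral M W (\<lambda>s. Re (f s)) \<omega>) +
     \<i> * of_real (wiener_integral M W (\<lambda>s. Im (f s)) \<omega>)"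


definition hermite_coeff :: "real \<Rightarrow> (real \<Rightarrow> complex) \<Rightarrow> nat \<Rightarrow> complex" where
  "hermite_coeff \<alpha> g n =
     (LINT t|lebesgue01. of_real (trans_hermite_fun \<alpha> n t) * g t * of_real (weight t))"

definition hermite_wiener_coeff ::
    "'a measure \<Rightarrow> (real \<Rightarrow> 'a \<Rightarrow> real) \<Rightarrow> real \<Rightarrow> nat \<Rightarrow> 'a \<Rightarrow> real" where
  "hermite_wiener_coeff M W \<alpha> n =
     wiener_integral M W (\<lambda>s. trans_hermite_fun \<alpha> n s * sqrt (weight s))"

definition fourier_kernel_partial ::
    "real \<Rightarrow> (real \<Rightarrow> complex) \<Rightarrow> real \<Rightarrow> nat \<Rightarrow> real \<Rightarrow> complex" where
  "fourier_kernel_partial \<alpha> g t N s =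
     (\<Sum>k<N. hermite_coeff \<alpha> g k * of_real (trans_hermite_fun \<alpha> k s) *
             fourier_trans_hermite_fun \<alpha> k t)"

text \<open>The sum of the kernel series in \<open>L\<^sup>2\<^sub>w(0,1)\<close> with respect to \<open>s\<close>, for fixed \<open>t\<close>; again a
  version is selected.\<close>

definition fourier_kernel :: "real \<Rightarrow> (real \<Rightarrow> complex) \<Rightarrow> real \<Rightarrow> real \<Rightarrow> complex" where
  "fourier_kernel \<alpha> g t = (SOME F. L2_tendsto weighted01 (fourier_kernel_partial \<alpha> g t) F)"

end

theory Submission
  imports Defs "HOL-Computational_Algebra.Polynomial"
begin

text \<open>
  The second claim is the image of the first under the Wiener integral. For fixed \<open>t\<close> put
  \<open>a\<^sub>k = b\<^sub>k \<cdot> \<lambda>\<^sub>k \<psi>\<^sub>k(\<phi>(t)/\<alpha>) / sqrt \<alpha>\<close>, where \<open>b\<^sub>k\<close> is the coefficient of \<open>g\<close>. The kernel is the series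
  \<open>\<Sum> a\<^sub>k e\<^sub>k\<close> in the transformed Hermite functions \<open>e\<^sub>k\<close>, and the stochastic series is the same series with
  each \<open>e\<^sub>k\<close> replaced by the Wiener integral of \<open>e\<^sub>k \<cdot> sqrt w\<close>. The map \<open>f \<mapsto> \<integral> f \<cdot> sqrt w dW\<close> is linear
  up to null sets and multiplies the norm of \<open>L\<^sup>2\<^sub>w(0,1)\<close> by \<open>c\<close>. Hence the mean square distance between
  the \<open>n\<close>-th partial sum of the stochastic series and the integral of the kernel is \<open>c\<^sup>2\<close> times the
  squared \<open>L\<^sup>2\<^sub>w\<close> distance between the \<open>n\<close>-th partial sum of the kernel series and the kernel
  (\<open>wiener_series_converges\<close>).

  Convergence of the kernel series (\<open>fourier_kernel_converges\<close>). The substitution \<open>u = \<phi>(x)\<close>, whose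
  Jacobian is the weight, carries \<open>L\<^sup>2\<^sub>w(0,1)\<close> to \<open>L\<^sup>2(\<real>)\<close>, so that orthonormality of the \<open>e\<^sub>k\<close> is
  orthonormality of the Hermite functions (\<open>trans_hermite_orthonormal\<close>). Bessel's inequality makes the
  \<open>b\<^sub>k\<close> square summable. The remaining factors of \<open>a\<^sub>k\<close> are bounded in \<open>k\<close>, because at a fixed point the
  Hermite functions are bounded in the index: this follows from a monotone energy for their
  differential equation (\<open>hermite_fun_bounded_in_index\<close>). Thus the \<open>a\<^sub>k\<close> are square summable, and
  completeness of \<open>L\<^sup>2\<close> gives a sum (\<open>Riesz_Fischer\<close>).

  The Wiener integral. By polarization the covariance of two increments of \<open>W\<close> is a combination of
  second moments of increments, and it equals \<open>c\<^sup>2\<close> times the length of the overlap of the two intervals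
  (\<open>increment_covariance\<close>, \<open>integral_indicator_Ioc_mult\<close>). This is the isometry on step functions. As step
  functions are dense in \<open>L\<^sup>2(0,1)\<close> (\<open>square_integrable_step_approximable\<close>) and \<open>L\<^sup>2\<close> of the probability
  space is complete, the integral exists for every square integrable function and the isometry passes
  to the limit (\<open>has_wiener_integral_wiener_integral\<close>, \<open>wiener_isometry\<close>).
\<close>


section \<open>Square-integrable functions\<close>

lemma square_integrableI:
  assumes "f \<in> borel_measurable N" "integrable N (\<lambda>x. (norm (f x))\<^sup>2)"
  shows "square_integrable N f"
  using assms by (simp add: square_integrable_def)

lemma square_integrableD [dest]:
  assumes "square_integrable N f"
  shows "f \<in> borel_measurable N" "integrable N (\<lambda>x. (norm (f x))\<^sup>2)"
  using assms by (auto simp: square_integrable_def)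

lemma square_integrable_realD:
  fixes f :: "'a \<Rightarrow> real"
  assumes "square_integrable N f"
  shows "integrable N (\<lambda>x. (f x)\<^sup>2)"
  using square_integrableD(2)[OF assms] by simp

lemma norm_add_sq_le: "(norm (x + y))\<^sup>2 \<le> 2 * (norm x)\<^sup>2 + 2 * (norm y)\<^sup>2"
proof -
  have "(norm (x + y))\<^sup>2 \<le> (norm x + norm y)\<^sup>2"
    by (intro power_mono norm_triangle_ineq) auto
  also have "\<dots> \<le> 2 * (norm x)\<^sup>2 + 2 * (norm y)\<^sup>2"
    using sum_squares_bound[of "norm x" "norm y"] by (simp add: power2_sum)
  finally show ?thesis .
qed

lemma square_integrable_zero [simp]: "square_integrable N (\<lambda>x. 0)"
  by (simp add: square_integrable_def)

lemma square_integrable_dominated: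
  assumes "f \<in> borel_measurable N" "square_integrable N g"
    and "\<And>x. x \<in> space N \<Longrightarrow> norm (f x) \<le> norm (g x)"
  shows "square_integrable N f"
proof (rule square_integrableI[OF assms(1)])
  show "integrable N (\<lambda>x. (norm (f x))\<^sup>2)"
    by (rule Bochner_Integration.integrable_bound[OF square_integrableD(2)[OF assms(2)]])
       (use assms in \<open>auto intro!: AE_I2 power_mono\<close>)
qed

lemma square_integrable_add:
  assumes "square_integrable N f" "square_integrable N g"
  shows "square_integrable N (\<lambda>x. f x + g x)"
proof (rule square_integrableI)
  note [measurable] = square_integrableD(1)[OF assms(1)] square_integrableD(1)[OF assms(2)]
  show "(\<lambda>x. f x + g x) \<in> borel_measurable N" by measurable
  show "integrable N (\<lambda>x. (norm (f x + g x))\<^sup>2)"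
  proof (rule Bochner_Integration.integrable_bound)
    show "integrable N (\<lambda>x. 2 * (norm (f x))\<^sup>2 + 2 * (norm (g x))\<^sup>2)"
      using assms by (auto simp: square_integrable_def)
    show "AE x in N. norm ((norm (f x + g x))\<^sup>2) \<le> norm (2 * (norm (f x))\<^sup>2 + 2 * (norm (g x))\<^sup>2)"
      using norm_add_sq_le[of "f _" "g _"] by auto
  qed measurable
qed

lemma square_integrable_cmult:
  fixes f :: "'a \<Rightarrow> 'b::{banach, second_countable_topology, real_normed_field}"
  assumes "square_integrable N f"
  shows "square_integrable N (\<lambda>x. a * f x)"
proof (rule square_integrableI)
  note [measurable] = square_integrableD(1)[OF assms(1)]
  show "(\<lambda>x. a * f x) \<in> borel_measurable N" by measurable
  show "integrable N (\<lambda>x. (norm (a * f x))\<^sup>2)"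
    using square_integrableD(2)[OF assms] by (simp add: norm_mult power_mult_distrib)
qed

lemma square_integrable_diff:
  assumes "square_integrable N f" "square_integrable N g"
  shows "square_integrable N (\<lambda>x. f x - g x)"
proof -
  have "square_integrable N (\<lambda>x. - g x)"
    using assms(2) by (auto simp: square_integrable_def)
  from square_integrable_add[OF assms(1) this] show ?thesis by simp
qed

lemma square_integrable_sum:
  assumes "\<And>k. k \<in> K \<Longrightarrow> square_integrable N (f k)"
  shows "square_integrable N (\<lambda>x. \<Sum>k\<in>K. f k x)"
  using assms by (induction K rule: infinite_finite_induct) (auto intro: square_integrable_add)

lemma square_integrable_of_real:
  assumes "square_integrable N f"
  shows "square_integrable N (\<lambda>x. of_real (f x) :: complex)"
  using assms unfolding square_integrable_def by auto

lemma square_integrable_Re_Im: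
  assumes "square_integrable N f"
  shows "square_integrable N (\<lambda>x. Re (f x))" "square_integrable N (\<lambda>x. Im (f x))"
proof -
  note [measurable] = square_integrableD(1)[OF assms]
  show "square_integrable N (\<lambda>x. Re (f x))"
    by (rule square_integrable_dominated[OF _ assms]) (auto simp: abs_Re_le_cmod)
  show "square_integrable N (\<lambda>x. Im (f x))"
    by (rule square_integrable_dominated[OF _ assms]) (auto simp: abs_Im_le_cmod)
qed

lemma square_integrable_mult_integrable:
  fixes f g :: "'a \<Rightarrow> real"
  assumes "square_integrable N f" "square_integrable N g"
  shows "integrable N (\<lambda>x. f x * g x)"
proof (rule Bochner_Integration.integrable_bound)
  note [measurable] = square_integrableD(1)[OF assms(1)] square_integrableD(1)[OF assms(2)]
  show "integrable N (\<lambda>x. (f x)\<^sup>2 + (g x)\<^sup>2)"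
    using assms by (auto intro: square_integrable_realD)
  have "\<bar>f x * g x\<bar> \<le> (f x)\<^sup>2 + (g x)\<^sup>2" for x
  proof -
    have "2 * (\<bar>f x\<bar> * \<bar>g x\<bar>) \<le> (f x)\<^sup>2 + (g x)\<^sup>2"
      using sum_squares_bound[of "\<bar>f x\<bar>" "\<bar>g x\<bar>"] by simp
    moreover have "0 \<le> \<bar>f x\<bar> * \<bar>g x\<bar>" by simp
    ultimately show ?thesis unfolding abs_mult by linarith
  qed
  then show "AE x in N. norm (f x * g x) \<le> norm ((f x)\<^sup>2 + (g x)\<^sup>2)"
    by auto
qed (use assms in \<open>auto simp: square_integrable_def\<close>)

lemma integral_norm_add_sq_le:
  assumes "square_integrable N f" "square_integrable N g"
  shows "(LINT x|N. (norm (f x + g x))\<^sup>2) \<le> 2 * (LINT x|N. (norm (f x))\<^sup>2) + 2 * (LINT x|N. (norm (g x))\<^sup>2)"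
proof -
  have "(LINT x|N. (norm (f x + g x))\<^sup>2) \<le> (LINT x|N. 2 * (norm (f x))\<^sup>2 + 2 * (norm (g x))\<^sup>2)"
    by (rule integral_mono)
       (use assms square_integrable_add[OF assms] in \<open>auto simp: square_integrable_def norm_add_sq_le\<close>)
  then show ?thesis
    using assms by (simp add: square_integrable_def)
qed

lemma L2_tendstoI:
  assumes "\<And>n. square_integrable N (X n)" "square_integrable N Y"
    and "(\<lambda>n. LINT x|N. (norm (X n x - Y x))\<^sup>2) \<longlonglongrightarrow> 0"
  shows "L2_tendsto N X Y"
  using assms by (simp add: L2_tendsto_def)

lemma L2_tendstoD:
  assumes "L2_tendsto N X Y"
  shows "square_integrable N (X n)" "square_integrable N Y"
    and "(\<lambda>n. LINT x|N. (norm (X n x - Y x))\<^sup>2) \<longlonglongrightarrow> 0"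
  using assms by (auto simp: L2_tendsto_def)

lemma L2_tendsto_add:
  assumes "L2_tendsto N X Y" "L2_tendsto N X' Y'"
  shows "L2_tendsto N (\<lambda>n x. X n x + X' n x) (\<lambda>x. Y x + Y' x)"
proof (rule L2_tendstoI)
  note XY = L2_tendstoD[OF assms(1)] and XY' = L2_tendstoD[OF assms(2)]
  show "square_integrable N (\<lambda>x. X n x + X' n x)" for n
    by (intro square_integrable_add XY XY')
  show "square_integrable N (\<lambda>x. Y x + Y' x)"
    by (intro square_integrable_add XY XY')
  have lim: "(\<lambda>n. 2 * (LINT x|N. (norm (X n x - Y x))\<^sup>2) + 2 * (LINT x|N. (norm (X' n x - Y' x))\<^sup>2)) \<longlonglongrightarrow> 2 * 0 + 2 * 0"
    by (intro tendsto_intros XY XY')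
  have "(LINT x|N. (norm (X n x + X' n x - (Y x + Y' x)))\<^sup>2) \<le>
      2 * (LINT x|N. (norm (X n x - Y x))\<^sup>2) + 2 * (LINT x|N. (norm (X' n x - Y' x))\<^sup>2)" for n
    using integral_norm_add_sq_le[of N "\<lambda>x. X n x - Y x" "\<lambda>x. X' n x - Y' x"] XY XY'
    by (auto simp: square_integrable_diff algebra_simps)
  then show "(\<lambda>n. LINT x|N. (norm (X n x + X' n x - (Y x + Y' x)))\<^sup>2) \<longlonglongrightarrow> 0"
    by (intro tendsto_sandwich[OF _ _ tendsto_const lim[simplified]] always_eventually) auto
qed

lemma L2_tendsto_cmult:
  fixes X :: "nat \<Rightarrow> 'a \<Rightarrow> 'b::{banach, second_countable_topology, real_normed_field}"
  assumes "L2_tendsto N X Y"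
  shows "L2_tendsto N (\<lambda>n x. a * X n x) (\<lambda>x. a * Y x)"
proof (rule L2_tendstoI)
  note XY = L2_tendstoD[OF assms(1)]
  show "square_integrable N (\<lambda>x. a * X n x)" for n
    by (intro square_integrable_cmult XY)
  show "square_integrable N (\<lambda>x. a * Y x)"
    by (intro square_integrable_cmult XY)
  have "(\<lambda>n. (norm a)\<^sup>2 * (LINT x|N. (norm (X n x - Y x))\<^sup>2)) \<longlonglongrightarrow> (norm a)\<^sup>2 * 0"
    by (intro tendsto_intros XY)
  then show "(\<lambda>n. LINT x|N. (norm (a * X n x - a * Y x))\<^sup>2) \<longlonglongrightarrow> 0"
    by (simp add: right_diff_distrib[symmetric] norm_mult power_mult_distrib)
qed

lemma L2_tendsto_const:
  assumes "square_integrable N f"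
  shows "L2_tendsto N (\<lambda>n. f) f"
  using assms by (simp add: L2_tendsto_def)

text \<open>The quadratic polynomial \<open>r \<mapsto> \<integral> (f + r g)\<^sup>2\<close> is nonnegative, so its discriminant is not positive.\<close>
lemma Cauchy_Schwarz_integral:
  fixes f g :: "'a \<Rightarrow> real"
  assumes f: "square_integrable N f" and g: "square_integrable N g"
  shows "(LINT x|N. f x * g x)\<^sup>2 \<le> (LINT x|N. (f x)\<^sup>2) * (LINT x|N. (g x)\<^sup>2)"
proof -
  define A where "A = (LINT x|N. (f x)\<^sup>2)"
  define B where "B = (LINT x|N. f x * g x)"
  define C where "C = (LINT x|N. (g x)\<^sup>2)"
  have nn: "0 \<le> A + 2 * r * B + r\<^sup>2 * C" for r
  proof -
    have "0 \<le> (LINT x|N. (f x + r * g x)\<^sup>2)" by simp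
    also have "(\<lambda>x. (f x + r * g x)\<^sup>2) = (\<lambda>x. (f x)\<^sup>2 + 2 * r * (f x * g x) + r\<^sup>2 * (g x)\<^sup>2)"
      by (auto simp: power2_eq_square algebra_simps)
    also have "(LINT x|N. \<dots> x) = A + 2 * r * B + r\<^sup>2 * C"
      using square_integrable_realD[OF f] square_integrable_realD[OF g] square_integrable_mult_integrable[OF f g]
      by (simp add: A_def B_def C_def)
    finally show ?thesis .
  qed
  have "C \<ge> 0" by (simp add: C_def)
  have "B\<^sup>2 \<le> A * C"
  proof (cases "C = 0")
    case True
    have "B = 0"
    proof (rule ccontr)
      assume "B \<noteq> 0"
      \<comment> \<open>At this \<open>r\<close> the polynomial, which is affine as \<open>C = 0\<close>, takes the value \<open>-1\<close>.\<close>
      with nn[of "- (A + 1) / (2 * B)"] True show False by (simp add: field_simps)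
    qed
    with True show ?thesis by simp
  next
    case False
    with \<open>C \<ge> 0\<close> have "C > 0" by simp
    \<comment> \<open>The polynomial is smallest at \<open>r = - B / C\<close>.\<close>
    have "A + 2 * (- B / C) * B + (- B / C)\<^sup>2 * C = A - B\<^sup>2 / C"
      using \<open>C > 0\<close> by (simp add: power2_eq_square field_simps)
    with nn[of "- B / C"] have "B\<^sup>2 / C \<le> A" by simp
    with \<open>C > 0\<close> show ?thesis by (simp add: divide_le_eq)
  qed
  then show ?thesis by (simp add: A_def B_def C_def)
qed

text \<open>From \<open>X\<^sup>2 = (X - Y)\<^sup>2 + 2 (X - Y) Y + Y\<^sup>2\<close>; the mixed term is controlled by the Cauchy-Schwarz inequality.
  This is what lets an isometry pass to \<open>L\<^sup>2\<close> limits.\<close>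
lemma L2_tendsto_integral_square:
  fixes X :: "nat \<Rightarrow> 'a \<Rightarrow> real"
  assumes "L2_tendsto N X Y"
  shows "(\<lambda>n. LINT x|N. (X n x)\<^sup>2) \<longlonglongrightarrow> (LINT x|N. (Y x)\<^sup>2)"
proof -
  note XY = L2_tendstoD[OF assms]
  define d where "d n = (LINT x|N. (X n x - Y x)\<^sup>2)" for n
  define e where "e n = (LINT x|N. (X n x - Y x) * Y x)" for n
  have d: "d \<longlonglongrightarrow> 0" using XY(3) by (simp add: d_def[abs_def])
  have D: "square_integrable N (\<lambda>x. X n x - Y x)" for n
    by (intro square_integrable_diff XY)
  have "(\<lambda>n. d n * (LINT x|N. (Y x)\<^sup>2)) \<longlonglongrightarrow> 0"
    using tendsto_mult_left_zero[OF d] by simp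
  then have "(\<lambda>n. (e n)\<^sup>2) \<longlonglongrightarrow> 0"
    by (rule tendsto_sandwich[OF _ _ tendsto_const, rotated 2])
       (auto simp: d_def e_def intro!: always_eventually Cauchy_Schwarz_integral[OF D XY(2)])
  then have e: "e \<longlonglongrightarrow> 0" by simp
  have eq: "(LINT x|N. (X n x)\<^sup>2) = d n + 2 * e n + (LINT x|N. (Y x)\<^sup>2)" for n
  proof -
    have "(\<lambda>x. (X n x)\<^sup>2) = (\<lambda>x. (X n x - Y x)\<^sup>2 + 2 * ((X n x - Y x) * Y x) + (Y x)\<^sup>2)"
      by (auto simp: power2_eq_square algebra_simps)
    then show ?thesis
      using square_integrable_realD[OF D[of n]] square_integrable_realD[OF XY(2)]
        square_integrable_mult_integrable[OF D[of n] XY(2)]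
      by (simp add: d_def e_def)
  qed
  have "(\<lambda>n. d n + 2 * e n + (LINT x|N. (Y x)\<^sup>2)) \<longlonglongrightarrow> 0 + 2 * 0 + (LINT x|N. (Y x)\<^sup>2)"
    by (intro tendsto_intros d e)
  then show ?thesis by (simp add: eq)
qed

lemma L2_tendsto_dominated:
  fixes f g :: "'a \<Rightarrow> real"
  assumes X: "\<And>n. X n \<in> borel_measurable N" and f: "f \<in> borel_measurable N"
    and g: "square_integrable N g"
    and lim: "\<And>x. x \<in> space N \<Longrightarrow> (\<lambda>n. X n x) \<longlonglongrightarrow> f x"
    and bound: "\<And>n x. x \<in> space N \<Longrightarrow> \<bar>X n x\<bar> \<le> \<bar>g x\<bar>"
  shows "L2_tendsto N X f"
proof (rule L2_tendstoI)
  note [measurable] = X f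
  have f_bound: "\<bar>f x\<bar> \<le> \<bar>g x\<bar>" if "x \<in> space N" for x
    using that by (intro LIMSEQ_le_const2[OF tendsto_rabs[OF lim]]) (auto intro: bound)
  show "square_integrable N (X n)" for n
    by (rule square_integrable_dominated[OF X g]) (simp add: bound)
  show "square_integrable N f"
    by (rule square_integrable_dominated[OF f g]) (simp add: f_bound)
  have "(\<lambda>n. LINT x|N. (norm (X n x - f x))\<^sup>2) \<longlonglongrightarrow> (LINT x|N. 0)"
  proof (rule integral_dominated_convergence)
    show "integrable N (\<lambda>x. 4 * (g x)\<^sup>2)"
      using square_integrable_realD[OF g] by simp
    show "AE x in N. (\<lambda>n. (norm (X n x - f x))\<^sup>2) \<longlonglongrightarrow> 0"
    proof (rule AE_I2)
      fix x assume "x \<in> space N"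
      from tendsto_power[OF tendsto_norm[OF tendsto_diff[OF lim[OF this] tendsto_const[of "f x"]]], of 2]
      show "(\<lambda>n. (norm (X n x - f x))\<^sup>2) \<longlonglongrightarrow> 0" by simp
    qed
    show "AE x in N. norm ((norm (X n x - f x))\<^sup>2) \<le> 4 * (g x)\<^sup>2" for n
    proof (rule AE_I2)
      fix x assume x: "x \<in> space N"
      have "\<bar>X n x - f x\<bar> \<le> 2 * \<bar>g x\<bar>"
        using bound[OF x, of n] f_bound[OF x] by linarith
      then have "\<bar>X n x - f x\<bar>\<^sup>2 \<le> (2 * \<bar>g x\<bar>)\<^sup>2" by (rule power_mono) simp
      then show "norm ((norm (X n x - f x))\<^sup>2) \<le> 4 * (g x)\<^sup>2"
        by (simp add: power_mult_distrib)
    qed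
  qed measurable
  then show "(\<lambda>n. LINT x|N. (norm (X n x - f x))\<^sup>2) \<longlonglongrightarrow> 0" by simp
qed

lemma L2_tendsto_cong_AE:
  assumes "L2_tendsto N X f" "g \<in> borel_measurable N" "AE x in N. f x = g x"
  shows "L2_tendsto N X g"
proof (rule L2_tendstoI)
  note Xf = L2_tendstoD[OF assms(1)]
  note [measurable] = assms(2) square_integrableD(1)[OF Xf(1)] square_integrableD(1)[OF Xf(2)]
  show "square_integrable N (X n)" for n by (rule Xf)
  show "square_integrable N g"
    using Xf(2) assms(3) unfolding square_integrable_def
    by (auto elim!: integrable_cong_AE_imp)
  have "(LINT x|N. (norm (X n x - g x))\<^sup>2) = (LINT x|N. (norm (X n x - f x))\<^sup>2)" for n
    using assms(3) by (intro integral_cong_AE) auto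
  with Xf(3) show "(\<lambda>n. LINT x|N. (norm (X n x - g x))\<^sup>2) \<longlonglongrightarrow> 0" by simp
qed

text \<open>Write \<open>D\<^sub>k\<close> for the difference of consecutive terms. The weights \<open>2\<^sup>k\<close> grow slowly enough that
  \<open>\<Sum> 2\<^sup>k |D\<^sub>k|\<^sup>2\<close> still has a finite integral, hence is finite almost everywhere; and there
  \<open>|D\<^sub>k| \<le> 2\<^sup>k |D\<^sub>k|\<^sup>2 + 2\<^sup>-\<^sup>k\<close> makes \<open>\<Sum> D\<^sub>k\<close> absolutely convergent.\<close>
lemma AE_convergent_of_fast_L2_Cauchy:
  fixes X :: "nat \<Rightarrow> 'a \<Rightarrow> 'b::{banach, second_countable_topology}"
  assumes sq: "\<And>k. square_integrable N (X k)"
    and fast: "\<And>k. (LINT x|N. (norm (X (Suc k) x - X k x))\<^sup>2) \<le> (1/4) ^ k"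
  shows "AE x in N. convergent (\<lambda>k. X k x)"
proof -
  define D where "D k x = X (Suc k) x - X k x" for k x
  have Dsq: "square_integrable N (D k)" for k
    unfolding D_def by (intro square_integrable_diff sq)
  note [measurable] = square_integrableD(1)[OF Dsq]
  have "(\<integral>\<^sup>+ x. (\<Sum>k. ennreal (2 ^ k * (norm (D k x))\<^sup>2)) \<partial>N) =
      (\<Sum>k. \<integral>\<^sup>+ x. ennreal (2 ^ k * (norm (D k x))\<^sup>2) \<partial>N)"
    by (rule nn_integral_suminf) measurable
  also have "\<dots> \<le> (\<Sum>k. ennreal ((1/2) ^ k))"
  proof (rule suminf_le)
    fix k
    have "(\<integral>\<^sup>+ x. ennreal (2 ^ k * (norm (D k x))\<^sup>2) \<partial>N) = ennreal (LINT x|N. 2 ^ k * (norm (D k x))\<^sup>2)"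
      using square_integrableD(2)[OF Dsq[of k]] by (intro nn_integral_eq_integral) auto
    also have "\<dots> \<le> ennreal (2 ^ k * (1/4) ^ k)"
      using fast[of k] by (intro ennreal_leI) (simp add: D_def)
    also have "(2::real) ^ k * (1/4) ^ k = (1/2) ^ k"
      by (simp add: power_mult_distrib[symmetric])
    finally show "(\<integral>\<^sup>+ x. ennreal (2 ^ k * (norm (D k x))\<^sup>2) \<partial>N) \<le> ennreal ((1/2) ^ k)" .
  qed auto
  also have "\<dots> < \<infinity>"
    by (subst suminf_ennreal2) (auto simp: summable_geometric)
  finally have "AE x in N. (\<Sum>k. ennreal (2 ^ k * (norm (D k x))\<^sup>2)) \<noteq> \<infinity>"
    by (intro nn_integral_PInf_AE) (auto simp: less_top)
  then show ?thesis
  proof eventually_elim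
    case (elim x)
    then have s: "summable (\<lambda>k. 2 ^ k * (norm (D k x))\<^sup>2)"
      by (intro summable_suminf_not_top) auto
    have bound: "norm (D k x) \<le> 2 ^ k * (norm (D k x))\<^sup>2 + (1/2) ^ k" for k
    proof (cases "norm (D k x) \<le> (1/2) ^ k")
      case True
      then show ?thesis by (simp add: add_increasing)
    next
      case False
      then have "1 \<le> 2 ^ k * norm (D k x)"
        by (simp add: field_simps power_one_over)
      then have "1 * norm (D k x) \<le> (2 ^ k * norm (D k x)) * norm (D k x)"
        by (rule mult_right_mono) auto
      then show ?thesis
        by (simp add: power2_eq_square mult.assoc add_increasing2)
    qed
    have "summable (\<lambda>k. 2 ^ k * (norm (D k x))\<^sup>2 + (1/2) ^ k)"
      by (intro summable_add s summable_geometric) auto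
    then have "summable (\<lambda>k. D k x)"
      by (rule summable_comparison_test[rotated]) (use bound in auto)
    then have "convergent (\<lambda>n. \<Sum>k<n. D k x)"
      by (simp add: summable_iff_convergent)
    then have "convergent (\<lambda>n. X 0 x + (\<Sum>k<n. D k x))"
      by (simp add: convergent_add_const_iff)
    also have "(\<lambda>n. X 0 x + (\<Sum>k<n. D k x)) = (\<lambda>n. X n x)"
      using sum_lessThan_telescope[of "\<lambda>k. X k x"] by (simp add: D_def)
    finally show "convergent (\<lambda>k. X k x)" .
  qed
qed

text \<open>A rapidly converging subsequence has an almost everywhere limit, and Fatou's lemma along this
  subsequence bounds the \<open>L\<^sup>2\<close> distance of any late term to that limit by the Cauchy modulus.\<close>
theorem L2_complete:
  fixes X :: "nat \<Rightarrow> 'a \<Rightarrow> 'b::{banach, second_countable_topology}"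
  assumes sq: "\<And>n. square_integrable N (X n)"
    and cauchy: "\<And>e. e > 0 \<Longrightarrow> \<exists>n0. \<forall>m\<ge>n0. \<forall>n\<ge>n0. (LINT x|N. (norm (X m x - X n x))\<^sup>2) < e"
  shows "\<exists>Y. L2_tendsto N X Y"
proof -
  have "\<exists>r. \<forall>m\<ge>r. \<forall>n\<ge>r. (LINT x|N. (norm (X m x - X n x))\<^sup>2) < (1/4) ^ k" for k
    by (rule cauchy) simp
  then obtain r where r: "\<And>k m n. m \<ge> r k \<Longrightarrow> n \<ge> r k \<Longrightarrow> (LINT x|N. (norm (X m x - X n x))\<^sup>2) < (1/4) ^ k"
    by metis
  \<comment> \<open>The partial sums turn the moduli \<open>r\<close>, which need not increase, into an increasing
    sequence above them; the summand \<open>k\<close> makes it tend to infinity.\<close>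
  define s where "s k = (\<Sum>j\<le>k. r j) + k" for k
  have s_ge: "s k \<ge> r k" for k
    unfolding s_def by (meson member_le_sum finite_atMost atMost_iff le_refl trans_le_add1 zero_le)
  have s_Suc: "s (Suc k) \<ge> r k" for k
    using s_ge[of k] by (simp add: s_def)
  note [measurable] = square_integrableD(1)[OF sq]
  have AE_conv: "AE x in N. convergent (\<lambda>k. X (s k) x)"
    by (rule AE_convergent_of_fast_L2_Cauchy) (use sq r s_ge s_Suc in \<open>auto intro: less_imp_le\<close>)
  define Y where "Y x = lim (\<lambda>k. X (s k) x)" for x
  have [measurable]: "Y \<in> borel_measurable N"
    unfolding Y_def by measurable
  have s_inf: "filterlim s at_top sequentially"
    by (rule filterlim_at_top_mono[OF filterlim_ident]) (auto simp: s_def)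
  have nn_le: "(\<integral>\<^sup>+ x. ennreal ((norm (X n x - Y x))\<^sup>2) \<partial>N) \<le> ennreal e"
    if e: "\<And>m. m \<ge> n0 \<Longrightarrow> (LINT x|N. (norm (X n x - X m x))\<^sup>2) \<le> e" for n n0 e
  proof -
    have "(\<integral>\<^sup>+ x. ennreal ((norm (X n x - Y x))\<^sup>2) \<partial>N) =
        (\<integral>\<^sup>+ x. liminf (\<lambda>k. ennreal ((norm (X n x - X (s k) x))\<^sup>2)) \<partial>N)"
    proof (rule nn_integral_cong_AE)
      show "AE x in N. ennreal ((norm (X n x - Y x))\<^sup>2) = liminf (\<lambda>k. ennreal ((norm (X n x - X (s k) x))\<^sup>2))"
        using AE_conv
      proof eventually_elim
        case (elim x)
        then have "(\<lambda>k. X (s k) x) \<longlonglongrightarrow> Y x"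
          by (simp add: Y_def convergent_LIMSEQ_iff)
        then have "(\<lambda>k. ennreal ((norm (X n x - X (s k) x))\<^sup>2)) \<longlonglongrightarrow> ennreal ((norm (X n x - Y x))\<^sup>2)"
          by (intro tendsto_intros)
        then show ?case
          by (rule lim_imp_Liminf[OF trivial_limit_sequentially, symmetric])
      qed
    qed
    also have "\<dots> \<le> liminf (\<lambda>k. \<integral>\<^sup>+ x. ennreal ((norm (X n x - X (s k) x))\<^sup>2) \<partial>N)"
      by (rule nn_integral_liminf) measurable
    also have "\<dots> \<le> ennreal e"
    proof -
      have "\<forall>\<^sub>F k in sequentially. s k \<ge> n0"
        using s_inf by (simp add: filterlim_at_top)
      then have "\<forall>\<^sub>F k in sequentially. (\<integral>\<^sup>+ x. ennreal ((norm (X n x - X (s k) x))\<^sup>2) \<partial>N) \<le> ennreal e"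
      proof eventually_elim
        case (elim k)
        have "(\<integral>\<^sup>+ x. ennreal ((norm (X n x - X (s k) x))\<^sup>2) \<partial>N) = ennreal (LINT x|N. (norm (X n x - X (s k) x))\<^sup>2)"
          using square_integrable_diff[OF sq sq, of n "s k"] by (intro nn_integral_eq_integral) auto
        then show ?case using e[OF elim] by (simp add: ennreal_leI)
      qed
      then have "limsup (\<lambda>k. \<integral>\<^sup>+ x. ennreal ((norm (X n x - X (s k) x))\<^sup>2) \<partial>N) \<le> ennreal e"
        by (rule Limsup_bounded)
      then show ?thesis
        by (rule order_trans[OF Liminf_le_Limsup[OF trivial_limit_sequentially]])
    qed
    finally show ?thesis .
  qed
  have diff_sq: "square_integrable N (\<lambda>x. X n x - Y x) \<and> (LINT x|N. (norm (X n x - Y x))\<^sup>2) \<le> e"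
    if "\<And>m. m \<ge> n0 \<Longrightarrow> (LINT x|N. (norm (X n x - X m x))\<^sup>2) \<le> e" for n n0 e
  proof
    have e: "e \<ge> 0"
      using that[OF order_refl] by (rule order_trans[rotated]) simp
    from nn_le[OF that] have le: "(\<integral>\<^sup>+ x. ennreal ((norm (X n x - Y x))\<^sup>2) \<partial>N) \<le> ennreal e" by blast
    then have int: "integrable N (\<lambda>x. (norm (X n x - Y x))\<^sup>2)"
      by (intro integrableI_bounded) (auto intro: le_less_trans[OF le])
    then show "square_integrable N (\<lambda>x. X n x - Y x)"
      by (intro square_integrableI) auto
    show "(LINT x|N. (norm (X n x - Y x))\<^sup>2) \<le> e"
      using le e nn_integral_eq_integral[OF int] by simp
  qed
  obtain n0 where n0: "\<And>m n. m \<ge> n0 \<Longrightarrow> n \<ge> n0 \<Longrightarrow> (LINT x|N. (norm (X m x - X n x))\<^sup>2) < 1"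
    using cauchy[of 1] by auto
  have "square_integrable N (\<lambda>x. X n0 x - Y x)"
    using diff_sq[of n0 n0 1] n0 by (auto intro: less_imp_le)
  from square_integrable_diff[OF sq[of n0] this] have Ysq: "square_integrable N Y"
    by simp
  have "(\<lambda>n. LINT x|N. (norm (X n x - Y x))\<^sup>2) \<longlonglongrightarrow> 0"
  proof (rule LIMSEQ_I)
    fix e :: real assume "e > 0"
    then obtain n1 where n1: "\<And>m n. m \<ge> n1 \<Longrightarrow> n \<ge> n1 \<Longrightarrow> (LINT x|N. (norm (X m x - X n x))\<^sup>2) < e/2"
      using cauchy[of "e/2"] by auto
    have "norm ((LINT x|N. (norm (X n x - Y x))\<^sup>2) - 0) < e" if "n \<ge> n1" for n
    proof -
      have "(LINT x|N. (norm (X n x - Y x))\<^sup>2) \<le> e/2"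
        using diff_sq[of n1 n "e/2"] n1[OF that] by (auto intro: less_imp_le)
      moreover have "(LINT x|N. (norm (X n x - Y x))\<^sup>2) \<ge> 0"
        by simp
      ultimately show ?thesis using \<open>e > 0\<close> by simp
    qed
    then show "\<exists>no. \<forall>n\<ge>no. norm ((LINT x|N. (norm (X n x - Y x))\<^sup>2) - 0) < e"
      by blast
  qed
  with sq Ysq show ?thesis
    by (blast intro: L2_tendstoI)
qed


section \<open>Orthonormal sequences\<close>

definition orthonormal :: "'a measure \<Rightarrow> (nat \<Rightarrow> 'a \<Rightarrow> real) \<Rightarrow> bool" where
  "orthonormal N e \<longleftrightarrow> (\<forall>k. square_integrable N (e k)) \<and>
     (\<forall>j k. (LINT x|N. e j x * e k x) = (if j = k then 1 else 0))"

lemma orthonormalD: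
  assumes "orthonormal N e"
  shows "square_integrable N (e k)" "(LINT x|N. e j x * e k x) = (if j = k then 1 else 0)"
  using assms by (auto simp: orthonormal_def)

lemma orthonormal_combination_sq:
  assumes "orthonormal N e" "finite K"
  shows "(LINT x|N. (\<Sum>k\<in>K. a k * e k x)\<^sup>2) = (\<Sum>k\<in>K. (a k)\<^sup>2)"
proof -
  note sq = orthonormalD(1)[OF assms(1)]
  have "(LINT x|N. (\<Sum>k\<in>K. a k * e k x)\<^sup>2) = (LINT x|N. (\<Sum>j\<in>K. \<Sum>k\<in>K. a j * a k * (e j x * e k x)))"
    by (simp add: power2_eq_square sum_product ac_simps)
  also have "\<dots> = (\<Sum>j\<in>K. \<Sum>k\<in>K. a j * a k * (LINT x|N. e j x * e k x))"
    using square_integrable_mult_integrable[OF sq sq] by simp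
  also have "\<dots> = (\<Sum>k\<in>K. (a k)\<^sup>2)"
    using assms(2) by (simp add: orthonormalD(2)[OF assms(1)] power2_eq_square if_distrib cong: if_cong)
  finally show ?thesis .
qed

lemma orthonormal_combination_cmod_sq:
  fixes a :: "nat \<Rightarrow> complex"
  assumes e: "orthonormal N e" and "finite K"
  shows "(LINT x|N. (norm (\<Sum>k\<in>K. a k * of_real (e k x)))\<^sup>2) = (\<Sum>k\<in>K. (norm (a k))\<^sup>2)"
proof -
  note sq = orthonormalD(1)[OF assms(1)]
  have int: "integrable N (\<lambda>x. (\<Sum>k\<in>K. b k * e k x)\<^sup>2)" for b :: "nat \<Rightarrow> real"
    by (intro square_integrable_realD square_integrable_sum square_integrable_cmult sq)
  have "(LINT x|N. (norm (\<Sum>k\<in>K. a k * of_real (e k x)))\<^sup>2) =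
      (LINT x|N. (\<Sum>k\<in>K. Re (a k) * e k x)\<^sup>2 + (\<Sum>k\<in>K. Im (a k) * e k x)\<^sup>2)"
    by (simp add: cmod_power2)
  also have "\<dots> = (\<Sum>k\<in>K. (Re (a k))\<^sup>2) + (\<Sum>k\<in>K. (Im (a k))\<^sup>2)"
    by (simp add: int orthonormal_combination_sq[OF assms])
  finally show ?thesis
    by (simp add: cmod_power2 sum.distrib)
qed

text \<open>Expand \<open>0 \<le> \<integral> (g - S)\<^sup>2\<close> for the projection \<open>S\<close> of \<open>g\<close> to the span of the first \<open>n\<close> functions.\<close>
lemma Bessel_inequality:
  assumes e: "orthonormal N e" and g: "square_integrable N g"
  shows "(\<Sum>k<n. (LINT x|N. e k x * g x)\<^sup>2) \<le> (LINT x|N. (g x)\<^sup>2)"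
proof -
  note sq = orthonormalD(1)[OF e]
  define a where "a k = (LINT x|N. e k x * g x)" for k
  define S where "S x = (\<Sum>k<n. a k * e k x)" for x
  have S: "square_integrable N S"
    unfolding S_def[abs_def] by (intro square_integrable_sum square_integrable_cmult sq)
  have Sg: "(LINT x|N. S x * g x) = (\<Sum>k<n. (a k)\<^sup>2)"
    using square_integrable_mult_integrable[OF sq g]
    by (simp add: S_def sum_distrib_right mult.assoc power2_eq_square a_def)
  have SS: "(LINT x|N. (S x)\<^sup>2) = (\<Sum>k<n. (a k)\<^sup>2)"
    unfolding S_def by (rule orthonormal_combination_sq[OF e]) simp
  have "0 \<le> (LINT x|N. (g x - S x)\<^sup>2)" by simp
  also have "(\<lambda>x. (g x - S x)\<^sup>2) = (\<lambda>x. (g x)\<^sup>2 - 2 * (S x * g x) + (S x)\<^sup>2)"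
    by (auto simp: power2_eq_square algebra_simps)
  also have "(LINT x|N. \<dots> x) = (LINT x|N. (g x)\<^sup>2) - 2 * (LINT x|N. S x * g x) + (LINT x|N. (S x)\<^sup>2)"
    using square_integrable_realD[OF g] square_integrable_realD[OF S] square_integrable_mult_integrable[OF S g]
    by simp
  finally show ?thesis by (simp add: Sg SS a_def)
qed

text \<open>As the \<open>e k\<close> are real, real and imaginary part of the coefficients are the coefficients of the real
  and imaginary part of \<open>g\<close>.\<close>
lemma summable_fourier_coefficients:
  fixes g :: "'a \<Rightarrow> complex"
  assumes e: "orthonormal N e" and g: "square_integrable N g"
  shows "summable (\<lambda>k. (norm (LINT x|N. of_real (e k x) * g x))\<^sup>2)"
proof -
  note sq = orthonormalD(1)[OF e] and g' = square_integrable_Re_Im[OF g]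
  have eq: "(norm (LINT x|N. of_real (e k x) * g x))\<^sup>2 =
      (LINT x|N. e k x * Re (g x))\<^sup>2 + (LINT x|N. e k x * Im (g x))\<^sup>2" for k
  proof -
    have "(\<lambda>x. of_real (e k x) * g x) = (\<lambda>x. of_real (e k x * Re (g x)) + \<i> * of_real (e k x * Im (g x)))"
      by (auto simp: complex_eq_iff)
    moreover have "integrable N (\<lambda>x. e k x * Re (g x))" "integrable N (\<lambda>x. e k x * Im (g x))"
      by (intro square_integrable_mult_integrable sq g')+
    ultimately have "(LINT x|N. of_real (e k x) * g x) =
        of_real (LINT x|N. e k x * Re (g x)) + \<i> * of_real (LINT x|N. e k x * Im (g x))"
      by (simp del: of_real_mult)
    then show ?thesis by (simp add: cmod_power2)
  qed
  have "summable (\<lambda>k. (LINT x|N. e k x * Re (g x))\<^sup>2)" "summable (\<lambda>k. (LINT x|N. e k x * Im (g x))\<^sup>2)"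
    by (rule summableI_nonneg_bounded, simp, rule Bessel_inequality[OF e], rule g')+
  then show ?thesis unfolding eq by (rule summable_add)
qed

text \<open>The squared norm of a block of the series is the corresponding block of \<open>\<Sum> |a\<^sub>k|\<^sup>2\<close>, so the partial sums
  are a Cauchy sequence.\<close>
lemma Riesz_Fischer:
  fixes a :: "nat \<Rightarrow> complex"
  assumes e: "orthonormal N e" and a: "summable (\<lambda>k. (norm (a k))\<^sup>2)"
  shows "\<exists>F. L2_tendsto N (\<lambda>n x. \<Sum>k<n. a k * of_real (e k x)) F"
proof (rule L2_complete)
  let ?S = "\<lambda>n x. \<Sum>k<n. a k * of_real (e k x)"
  show "square_integrable N (?S n)" for n
    by (intro square_integrable_sum square_integrable_cmult square_integrable_of_real orthonormalD[OF e])
  fix r :: real assume "r > 0"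
  then obtain n0 where n0: "\<And>m n. m \<ge> n0 \<Longrightarrow> norm (\<Sum>k=m..<n. (norm (a k))\<^sup>2) < r"
    using a unfolding summable_Cauchy by blast
  have tail: "(LINT x|N. (norm (?S m x - ?S n x))\<^sup>2) < r" if "n0 \<le> m" "m \<le> n" for m n
  proof -
    have "norm (?S m x - ?S n x) = norm (\<Sum>k=m..<n. a k * of_real (e k x))" for x
      using sum_diff_nat_ivl[of 0 m n "\<lambda>k. a k * of_real (e k x)"] that(2)
      by (subst norm_minus_commute) (simp add: atLeast0LessThan)
    then have "(LINT x|N. (norm (?S m x - ?S n x))\<^sup>2) = (\<Sum>k=m..<n. (norm (a k))\<^sup>2)"
      using orthonormal_combination_cmod_sq[OF e, of "{m..<n}" a] by simp
    also have "\<dots> < r" using n0[OF that(1), of n] by simp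
    finally show ?thesis .
  qed
  have "(LINT x|N. (norm (?S m x - ?S n x))\<^sup>2) < r" if "m \<ge> n0" "n \<ge> n0" for m n
  proof (cases "m \<le> n")
    case True
    with tail that show ?thesis by blast
  next
    case False
    then have "(LINT x|N. (norm (?S n x - ?S m x))\<^sup>2) < r" using tail that by simp
    then show ?thesis by (subst norm_minus_commute)
  qed
  then show "\<exists>n0. \<forall>m\<ge>n0. \<forall>n\<ge>n0. (LINT x|N. (norm (?S m x - ?S n x))\<^sup>2) < r" by blast
qed


section \<open>Hermite functions\<close>

text \<open>The Hermite polynomials as formal polynomials. The recursion is the one that differentiating
  \<open>p(x) exp(- x\<^sup>2)\<close> imposes on the polynomial factor, up to sign.\<close>
fun herm :: "nat \<Rightarrow> real poly" where
  "herm 0 = 1"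
| "herm (Suc n) = [:0, 2:] * herm n - pderiv (herm n)"

lemma has_real_derivative_poly_gaussian:
  "((\<lambda>x. poly p x * exp (- x\<^sup>2)) has_real_derivative
      poly (pderiv p - [:0, 2:] * p) x * exp (- x\<^sup>2)) (at x)"
  by (rule derivative_eq_intros poly_DERIV refl)+ (simp add: algebra_simps)

lemma iterated_deriv_gaussian:
  "(deriv ^^ n) (\<lambda>u. exp (- u\<^sup>2)) = (\<lambda>u::real. poly (smult ((-1) ^ n) (herm n)) u * exp (- u\<^sup>2))"
proof (induction n)
  case (Suc n)
  have "deriv (\<lambda>u. poly (smult ((-1) ^ n) (herm n)) u * exp (- u\<^sup>2)) t =
      poly (smult ((-1) ^ Suc n) (herm (Suc n))) t * exp (- t\<^sup>2)" for t :: real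
    by (rule trans[OF DERIV_imp_deriv[OF has_real_derivative_poly_gaussian]])
       (simp add: pderiv_smult algebra_simps)
  then show ?case
    by (simp only: funpow.simps o_apply Suc.IH)
qed simp

lemma hermite_poly_eq: "hermite_poly n = poly (herm n)"
proof
  fix t
  have "hermite_poly n t = ((-1) ^ n * (-1) ^ n) * poly (herm n) t * (exp (t\<^sup>2) * exp (- t\<^sup>2))"
    by (simp add: hermite_poly_def iterated_deriv_gaussian)
  also have "(-1 :: real) ^ n * (-1) ^ n = 1"
    by (simp flip: power_mult_distrib)
  also have "exp (t\<^sup>2) * exp (- t\<^sup>2) = 1"
    by (simp flip: exp_add)
  finally show "hermite_poly n t = poly (herm n) t" by simp
qed

text \<open>Differentiating the recursion and inserting the induction hypothesis twice reproduces the recursion.\<close>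
lemma pderiv_herm_Suc: "pderiv (herm (Suc n)) = smult (2 * real (Suc n)) (herm n)"
proof (induction n)
  case (Suc n)
  have "pderiv (herm (Suc (Suc n))) =
      smult 2 (herm (Suc n)) + [:0, 2:] * pderiv (herm (Suc n)) - pderiv (pderiv (herm (Suc n)))"
    unfolding herm.simps(2)[of "Suc n"] by (simp only: pderiv_diff pderiv_mult) (simp add: pderiv_pCons)
  also have "\<dots> = smult 2 (herm (Suc n)) + smult (2 * real (Suc n)) ([:0, 2:] * herm n - pderiv (herm n))"
    unfolding Suc.IH by (simp add: pderiv_smult smult_diff_right)
  also have "\<dots> = smult (2 * real (Suc (Suc n))) (herm (Suc n))"
    unfolding herm.simps(2)[of n, symmetric] smult_add_left[symmetric] by simp
  finally show ?case .
qed (simp add: pderiv_pCons)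

text \<open>Hermite's equation \<open>y'' - 2 x y' + 2 n y = 0\<close>: differentiate the recursion and insert the
  formula for the derivative of the next polynomial.\<close>
lemma herm_ODE:
  "pderiv (pderiv (herm n)) - [:0, 2:] * pderiv (herm n) + smult (2 * real n) (herm n) = 0"
proof -
  have "pderiv (herm (Suc n)) = smult 2 (herm n) + [:0, 2:] * pderiv (herm n) - pderiv (pderiv (herm n))"
    unfolding herm.simps(2) by (simp only: pderiv_diff pderiv_mult) (simp add: pderiv_pCons)
  then have "smult 2 (herm n) + [:0, 2:] * pderiv (herm n) - pderiv (pderiv (herm n)) =
      smult 2 (herm n) + smult (2 * real n) (herm n)"
    unfolding pderiv_herm_Suc by (simp add: smult_add_left[symmetric])
  then show ?thesis by (simp add: algebra_simps)
qed

lemma tendsto_poly_gaussian: "((\<lambda>x::real. poly p x * exp (- x\<^sup>2)) \<longlongrightarrow> 0) at_infinity"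
proof -
  have mono: "((\<lambda>x::real. x ^ i * exp (- x\<^sup>2)) \<longlongrightarrow> 0) at_infinity" for i
  proof (rule Lim_null_comparison)
    have "((\<lambda>x::real. norm x ^ i / exp (norm x)) \<longlongrightarrow> 0) at_infinity"
      by (rule filterlim_compose[OF tendsto_power_div_exp_0 filterlim_norm_at_top])
    then show "((\<lambda>x::real. \<bar>x\<bar> ^ i / exp \<bar>x\<bar>) \<longlongrightarrow> 0) at_infinity" by simp
    have "norm (x ^ i * exp (- x\<^sup>2)) \<le> \<bar>x\<bar> ^ i / exp \<bar>x\<bar>" if "1 \<le> norm x" for x :: real
    proof -
      have "\<bar>x\<bar> * 1 \<le> \<bar>x\<bar> * \<bar>x\<bar>" using that by (intro mult_left_mono) auto
      then have "exp (- x\<^sup>2) \<le> exp (- \<bar>x\<bar>)" by (simp add: power2_eq_square)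
      then have "\<bar>x\<bar> ^ i * exp (- x\<^sup>2) \<le> \<bar>x\<bar> ^ i * exp (- \<bar>x\<bar>)" by (rule mult_left_mono) simp
      then show ?thesis by (simp add: abs_mult power_abs exp_minus field_simps)
    qed
    then show "\<forall>\<^sub>F x in at_infinity. norm (x ^ i * exp (- x\<^sup>2)) \<le> \<bar>x\<bar> ^ i / exp \<bar>x\<bar>"
      unfolding eventually_at_infinity by blast
  qed
  have "((\<lambda>x::real. \<Sum>i\<le>degree p. coeff p i * (x ^ i * exp (- x\<^sup>2))) \<longlongrightarrow> (\<Sum>i\<le>degree p. coeff p i * 0)) at_infinity"
    by (intro tendsto_intros mono)
  then show ?thesis
    by (simp add: poly_altdef sum_distrib_right mult.assoc)
qed

lemma exp_minus_sq_eq_normal_density: "exp (- x\<^sup>2) = sqrt pi * normal_density 0 (1 / sqrt 2) x"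
  by (simp add: normal_density_def power_divide real_sqrt_divide)

lemma integrable_poly_gaussian: "integrable lborel (\<lambda>x. poly p x * exp (- x\<^sup>2) :: real)"
proof -
  have "integrable lborel (\<lambda>x. coeff p i * (sqrt pi * (normal_density 0 (1 / sqrt 2) x * (x - 0) ^ i)))" for i
    by (intro integrable_mult_right integrable_normal_moment) simp
  then have "integrable lborel (\<lambda>x. \<Sum>i\<le>degree p. coeff p i * (sqrt pi * (normal_density 0 (1 / sqrt 2) x * (x - 0) ^ i)))"
    by (intro Bochner_Integration.integrable_sum)
  also have "(\<lambda>x. \<Sum>i\<le>degree p. coeff p i * (sqrt pi * (normal_density 0 (1 / sqrt 2) x * (x - 0) ^ i))) =
      (\<lambda>x. poly p x * exp (- x\<^sup>2))"
    by (auto simp: poly_altdef sum_distrib_left exp_minus_sq_eq_normal_density ac_simps)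
  finally show ?thesis .
qed

definition gaussian_integral :: "real poly \<Rightarrow> real" where
  "gaussian_integral p = (LINT x|lborel. poly p x * exp (- x\<^sup>2))"

lemma gaussian_integral_diff: "gaussian_integral (p - q) = gaussian_integral p - gaussian_integral q"
  unfolding gaussian_integral_def
  by (subst Bochner_Integration.integral_diff[symmetric]) (auto intro: integrable_poly_gaussian simp: algebra_simps)

lemma gaussian_integral_smult: "gaussian_integral (smult a p) = a * gaussian_integral p"
  by (simp add: gaussian_integral_def mult.assoc)

lemma gaussian_integral_1: "gaussian_integral 1 = sqrt pi"
  using integral_normal_moment_even[of "1 / sqrt 2" 0 0]
  by (simp add: gaussian_integral_def exp_minus_sq_eq_normal_density)

text \<open>The integrand is the derivative of \<open>p(x) exp(- x\<^sup>2)\<close>, which vanishes at both ends of the real line.\<close>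
lemma gaussian_integral_derivative: "gaussian_integral (pderiv p - [:0, 2:] * p) = 0"
proof -
  let ?F = "\<lambda>x. poly p x * exp (- x\<^sup>2)" and ?f = "\<lambda>x. poly (pderiv p - [:0, 2:] * p) x * exp (- x\<^sup>2)"
  have "(LBINT x=-\<infinity>..\<infinity>. ?f x) = 0 - 0"
  proof (rule interval_integral_FTC_integrable)
    show "(?F has_vector_derivative ?f x) (at x)" for x
      using has_real_derivative_poly_gaussian by (simp add: has_real_derivative_iff_has_vector_derivative)
    show "isCont ?f x" for x
      by (intro continuous_intros)
    show "set_integrable lborel (einterval (-\<infinity>) \<infinity>) ?f"
      using integrable_poly_gaussian[of "pderiv p - [:0, 2:] * p"]
      by (simp only: set_integrable_def einterval_eq indicator_UNIV scaleR_one)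
    show "((?F \<circ> real_of_ereal) \<longlongrightarrow> 0) (at_right (-\<infinity>))"
      unfolding ereal_tendsto_simps using tendsto_poly_gaussian
      by (rule tendsto_mono[OF at_bot_le_at_infinity])
    show "((?F \<circ> real_of_ereal) \<longlongrightarrow> 0) (at_left \<infinity>)"
      unfolding ereal_tendsto_simps using tendsto_poly_gaussian
      by (rule tendsto_mono[OF at_top_le_at_infinity])
  qed simp
  then show ?thesis
    by (simp add: gaussian_integral_def interval_lebesgue_integral_def set_lebesgue_integral_def)
qed

text \<open>Integration by parts: \<open>herm (Suc n)(x) exp(- x\<^sup>2)\<close> is minus the derivative of \<open>herm n(x) exp(- x\<^sup>2)\<close>.\<close>
lemma gaussian_integral_herm_Suc:
  "gaussian_integral (p * herm (Suc n)) = gaussian_integral (pderiv p * herm n)"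
proof -
  have "p * herm (Suc n) = pderiv p * herm n - (pderiv (p * herm n) - [:0, 2:] * (p * herm n))"
    unfolding herm.simps(2) pderiv_mult by (simp only: algebra_simps)
  then show ?thesis
    by (simp only: gaussian_integral_diff[of "pderiv p * herm n"] gaussian_integral_derivative)
qed

text \<open>Each integration by parts lowers both degrees by one, until one factor is constant; if the other is
  not, a further integration by parts gives \<open>0\<close>.\<close>
lemma gaussian_integral_herm_herm:
  "gaussian_integral (herm m * herm n) = (if m = n then 2 ^ n * fact n * sqrt pi else 0)"
proof (induction n arbitrary: m)
  case 0
  show ?case
  proof (cases m)
    case (Suc k)
    have "gaussian_integral (herm m * herm 0) = gaussian_integral (1 * herm (Suc k))"
      by (simp only: Suc herm.simps(1) mult_1 mult_1_right)
    also have "\<dots> = 0"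
      unfolding gaussian_integral_herm_Suc by (simp add: gaussian_integral_def)
    finally show ?thesis using Suc by simp
  qed (simp add: gaussian_integral_1)
next
  case (Suc n)
  show ?case
  proof (cases m)
    case 0
    then show ?thesis unfolding gaussian_integral_herm_Suc by (simp add: gaussian_integral_def)
  next
    case (Suc k)
    show ?thesis
      unfolding gaussian_integral_herm_Suc Suc pderiv_herm_Suc mult_smult_left gaussian_integral_smult Suc.IH
      by simp
  qed
qed

lemma hermite_fun_eq:
  "hermite_fun n t = poly (herm n) t * exp (- t\<^sup>2 / 2) / sqrt (2 ^ n * fact n * sqrt pi)"
  by (simp add: hermite_fun_def hermite_poly_eq)

lemma hermite_fun_borel [measurable]: "hermite_fun n \<in> borel_measurable borel"
  unfolding hermite_fun_eq[abs_def]
  by (intro borel_measurable_continuous_onI continuous_intros) auto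

lemma hermite_fun_mult:
  "hermite_fun m t * hermite_fun n t =
     poly (herm m * herm n) t * exp (- t\<^sup>2) / (sqrt (2 ^ m * fact m * sqrt pi) * sqrt (2 ^ n * fact n * sqrt pi))"
proof -
  have "exp (- t\<^sup>2) = exp (- t\<^sup>2 / 2) * exp (- t\<^sup>2 / 2)"
    by (simp flip: exp_add)
  then show ?thesis by (simp add: hermite_fun_eq)
qed

theorem hermite_fun_orthonormal:
  "integrable lborel (\<lambda>x. hermite_fun m x * hermite_fun n x)"
  "(LINT x|lborel. hermite_fun m x * hermite_fun n x) = (if m = n then 1 else 0)"
proof -
  let ?c = "sqrt (2 ^ m * fact m * sqrt pi) * sqrt (2 ^ n * fact n * sqrt pi)"
  show "integrable lborel (\<lambda>x. hermite_fun m x * hermite_fun n x)"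
    unfolding hermite_fun_mult by (intro integrable_divide integrable_poly_gaussian)
  have "(LINT x|lborel. hermite_fun m x * hermite_fun n x) = gaussian_integral (herm m * herm n) / ?c"
    unfolding hermite_fun_mult gaussian_integral_def by (rule integral_divide_zero)
  also have "\<dots> = (if m = n then 1 else 0)"
    unfolding gaussian_integral_herm_herm by simp
  finally show "(LINT x|lborel. hermite_fun m x * hermite_fun n x) = (if m = n then 1 else 0)" .
qed

lemma herm_at_0_Suc_Suc: "poly (herm (Suc (Suc n))) 0 = - 2 * real (Suc n) * poly (herm n) 0"
  unfolding herm.simps(2)[of "Suc n"] pderiv_herm_Suc by (simp add: algebra_simps)

text \<open>The two-step recursion at \<open>0\<close> multiplies the square by \<open>4 (n + 1)\<^sup>2\<close>, the right-hand side by the larger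
  \<open>4 (n + 1) (n + 2)\<close>.\<close>
lemma herm_at_0_sq_le: "(poly (herm n) 0)\<^sup>2 \<le> 2 ^ n * fact n"
proof (induction n rule: induct_nat_012)
  case (ge2 n)
  have "(poly (herm (Suc (Suc n))) 0)\<^sup>2 = 4 * (real (Suc n))\<^sup>2 * (poly (herm n) 0)\<^sup>2"
    unfolding herm_at_0_Suc_Suc power_mult_distrib by simp
  also have "\<dots> \<le> (4 * (real (Suc n) * real (Suc (Suc n)))) * (2 ^ n * fact n)"
    by (intro mult_mono ge2) (auto simp: power2_eq_square)
  also have "\<dots> = 2 ^ Suc (Suc n) * fact (Suc (Suc n))"
    by (simp add: algebra_simps)
  finally show ?case .
qed simp_all

text \<open>The function \<open>u(y) = herm n(y) exp(- y\<^sup>2/2)\<close> solves \<open>u'' = (y\<^sup>2 - (2 n + 1)) u\<close>. For its energy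
  \<open>E = u'\<^sup>2 + (2 n + 1) u\<^sup>2\<close> one has \<open>E' = 2 y\<^sup>2 u u'\<close> and so \<open>|E'| \<le> y\<^sup>2 E\<close>, which gives
  \<open>E(x) \<le> E(0) exp(|x|\<^sup>3/3)\<close>. The values of the Hermite polynomials at \<open>0\<close> show that \<open>E(0)\<close> is at most
  \<open>3 (2 n + 1)\<close> times \<open>2\<^sup>n n!\<close>; the factor \<open>2 n + 1\<close> cancels against the one in the energy, and \<open>2\<^sup>n n!\<close>
  against the normalization.\<close>
lemma hermite_fun_bounded_in_index:
  "\<exists>C. \<forall>n. (hermite_fun n x)\<^sup>2 \<le> C"
proof (intro exI allI)
  fix n
  define u where "u y = poly (herm n) y * exp (- y\<^sup>2 / 2)" for y
  define v where "v y = poly (pderiv (herm n) - [:0, 1:] * herm n) y * exp (- y\<^sup>2 / 2)" for y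
  define E where "E y = (v y)\<^sup>2 + (2 * real n + 1) * (u y)\<^sup>2" for y
  have u: "(u has_real_derivative v y) (at y)" for y
    unfolding u_def[abs_def] v_def
    by (auto intro!: derivative_eq_intros simp: algebra_simps)
  have v: "(v has_real_derivative (y\<^sup>2 - (2 * real n + 1)) * u y) (at y)" for y
  proof -
    have ODE: "poly (pderiv (pderiv (herm n))) y = 2 * y * poly (pderiv (herm n)) y - 2 * real n * poly (herm n) y"
      using arg_cong[OF herm_ODE[of n], of "\<lambda>p. poly p y"] by simp
    show ?thesis
      unfolding v_def[abs_def] u_def
      by (auto intro!: derivative_eq_intros
          simp: pderiv_diff pderiv_mult pderiv_pCons ODE power2_eq_square algebra_simps)
  qed
  have E: "(E has_real_derivative 2 * y\<^sup>2 * (u y * v y)) (at y)" for y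
    unfolding E_def[abs_def]
    by (auto intro!: derivative_eq_intros u v simp: algebra_simps)
  have bound: "\<bar>2 * (u y * v y)\<bar> \<le> E y" for y
  proof -
    have "2 * (\<bar>u y\<bar> * \<bar>v y\<bar>) \<le> 1 * (u y)\<^sup>2 + (v y)\<^sup>2"
      using sum_squares_bound[of "\<bar>u y\<bar>" "\<bar>v y\<bar>"] by simp
    also have "\<dots> \<le> (2 * real n + 1) * (u y)\<^sup>2 + (v y)\<^sup>2"
      by (intro add_right_mono mult_right_mono) auto
    finally show ?thesis by (simp add: E_def abs_mult)
  qed
  have E_le: "E x \<le> E 0 * exp (\<bar>x\<bar> ^ 3 / 3)"
  proof (cases "x \<ge> 0")
    case True
    have "E x * exp (- (x ^ 3 / 3)) \<le> E 0 * exp (- (0 ^ 3 / 3))"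
    proof (rule DERIV_nonpos_imp_nonincreasing[OF True])
      fix y :: real assume "0 \<le> y"
      have "((\<lambda>y. E y * exp (- (y ^ 3 / 3))) has_real_derivative
          y\<^sup>2 * (2 * (u y * v y) - E y) * exp (- (y ^ 3 / 3))) (at y)"
        by (auto intro!: derivative_eq_intros E simp: algebra_simps)
      moreover have "y\<^sup>2 * (2 * (u y * v y) - E y) * exp (- (y ^ 3 / 3)) \<le> 0"
        using bound[of y] by (intro mult_nonpos_nonneg mult_nonneg_nonpos) auto
      ultimately show "\<exists>D. ((\<lambda>y. E y * exp (- (y ^ 3 / 3))) has_real_derivative D) (at y) \<and> D \<le> 0"
        by blast
    qed
    then show ?thesis using True by (simp add: exp_minus field_simps)
  next
    case False
    then have "x \<le> 0" by simp
    have "E x * exp (x ^ 3 / 3) \<le> E 0 * exp (0 ^ 3 / 3)"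
    proof (rule DERIV_nonneg_imp_nondecreasing[OF \<open>x \<le> 0\<close>])
      fix y :: real assume "x \<le> y"
      have "((\<lambda>y. E y * exp (y ^ 3 / 3)) has_real_derivative
          y\<^sup>2 * (2 * (u y * v y) + E y) * exp (y ^ 3 / 3)) (at y)"
        by (auto intro!: derivative_eq_intros E simp: algebra_simps)
      moreover have "y\<^sup>2 * (2 * (u y * v y) + E y) * exp (y ^ 3 / 3) \<ge> 0"
        using bound[of y] by (intro mult_nonneg_nonneg) auto
      ultimately show "\<exists>D. ((\<lambda>y. E y * exp (y ^ 3 / 3)) has_real_derivative D) (at y) \<and> D \<ge> 0"
        by blast
    qed
    then show ?thesis using False by (simp add: exp_minus field_simps)
  qed
  have v0: "v 0 = - poly (herm (Suc n)) 0" by (simp add: v_def)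
  have "E 0 \<le> 2 ^ Suc n * fact (Suc n) + (2 * real n + 1) * (2 ^ n * fact n)"
    unfolding E_def v0 power2_minus u_def
    by (intro add_mono mult_left_mono herm_at_0_sq_le) (auto simp: herm_at_0_sq_le)
  also have "\<dots> = (4 * real n + 3) * (2 ^ n * fact n)"
    by (simp add: algebra_simps)
  also have "\<dots> \<le> (3 * (2 * real n + 1)) * (2 ^ n * fact n)"
    by (intro mult_right_mono) auto
  finally have E0: "E 0 \<le> (2 * real n + 1) * (3 * (2 ^ n * fact n))"
    by (simp only: mult.assoc mult.left_commute)
  have "(2 * real n + 1) * (u x)\<^sup>2 \<le> E x" by (simp add: E_def)
  also have "\<dots> \<le> (2 * real n + 1) * (3 * (2 ^ n * fact n)) * exp (\<bar>x\<bar> ^ 3 / 3)"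
    by (intro order_trans[OF E_le] mult_right_mono E0) auto
  also have "\<dots> = (2 * real n + 1) * (3 * (2 ^ n * fact n) * exp (\<bar>x\<bar> ^ 3 / 3))" by simp
  finally have u_le: "(u x)\<^sup>2 \<le> 3 * (2 ^ n * fact n) * exp (\<bar>x\<bar> ^ 3 / 3)"
    by (subst (asm) mult_le_cancel_left_pos) auto
  have "(hermite_fun n x)\<^sup>2 = (u x)\<^sup>2 / (2 ^ n * fact n * sqrt pi)"
    by (simp add: hermite_fun_eq u_def power_divide)
  also have "\<dots> \<le> 3 * (2 ^ n * fact n) * exp (\<bar>x\<bar> ^ 3 / 3) / (2 ^ n * fact n * sqrt pi)"
    by (intro divide_right_mono u_le) simp
  also have "\<dots> = 3 * exp (\<bar>x\<bar> ^ 3 / 3) / sqrt pi" by simp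
  finally show "(hermite_fun n x)\<^sup>2 \<le> 3 * exp (\<bar>x\<bar> ^ 3 / 3) / sqrt pi" .
qed


section \<open>The weighted space on the unit interval\<close>

lemma borel_measurable_lebesgue01:
  "f \<in> borel_measurable borel \<Longrightarrow> f \<in> borel_measurable lebesgue01"
  by (intro measurable_restrict_space1 measurable_completion) simp

lemma weight_borel [measurable]: "weight \<in> borel_measurable borel"
  unfolding weight_def[abs_def] by measurable

lemma phi_borel [measurable]: "phi \<in> borel_measurable borel"
  unfolding phi_def[abs_def] by measurable

lemma weight_pos: "x \<in> {0<..<1} \<Longrightarrow> weight x > 0"
  by (simp add: weight_def)

lemma AE_weight_nonneg: "AE x in lebesgue01. 0 \<le> weight x"
  by (rule AE_I2) (simp add: less_imp_le weight_pos)

lemma weighted01_integrable_iff: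
  fixes f :: "real \<Rightarrow> 'b::{banach, second_countable_topology}"
  assumes "f \<in> borel_measurable lebesgue01"
  shows "integrable weighted01 f \<longleftrightarrow> integrable lebesgue01 (\<lambda>x. weight x *\<^sub>R f x)"
  unfolding weighted01_def
  by (rule integrable_density[OF assms borel_measurable_lebesgue01 AE_weight_nonneg]) measurable

lemma weighted01_integral:
  fixes f :: "real \<Rightarrow> 'b::{banach, second_countable_topology}"
  assumes "f \<in> borel_measurable lebesgue01"
  shows "integral\<^sup>L weighted01 f = (LINT x|lebesgue01. weight x *\<^sub>R f x)"
  unfolding weighted01_def
  by (rule integral_density[OF assms borel_measurable_lebesgue01 AE_weight_nonneg]) measurable

lemma inj_on_phi: "inj_on phi {0<..<1}"
proof (rule inj_onI)
  fix x y :: real assume "x \<in> {0<..<1}" "y \<in> {0<..<1}" "phi x = phi y"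
  then have "x / (1 - x) = y / (1 - y)" by (simp add: phi_def)
  with \<open>x \<in> _\<close> \<open>y \<in> _\<close> show "x = y" by (simp add: field_simps)
qed

lemma range_phi: "phi ` {0<..<1} = UNIV"
proof -
  have "\<exists>x\<in>{0<..<1}. phi x = y" for y
  proof
    have "exp y / (1 + exp y) / (1 - exp y / (1 + exp y)) = exp y"
      by (simp add: field_simps add_pos_pos less_imp_neq[symmetric])
    then show "phi (exp y / (1 + exp y)) = y" by (simp add: phi_def)
    show "exp y / (1 + exp y) \<in> {0<..<1}" by (simp add: add_pos_pos)
  qed
  then show ?thesis by (auto simp: image_iff) metis
qed

text \<open>Substitution \<open>u = \<phi>(x)\<close>, where \<open>\<phi>' = w\<close>.\<close>
lemma weighted01_integral_phi:
  fixes f :: "real \<Rightarrow> real"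
  assumes f: "integrable lborel f"
  shows "integrable weighted01 (\<lambda>x. f (phi x))" "(LINT x|weighted01. f (phi x)) = (LINT u|lborel. f u)"
proof -
  have [measurable]: "f \<in> borel_measurable borel" using borel_measurable_integrable[OF f] by simp
  have fphi: "(\<lambda>x. f (phi x)) \<in> borel_measurable lebesgue01"
    by (rule borel_measurable_lebesgue01) measurable
  have leb: "integrable lebesgue f"
    using f by (simp add: integrable_completion)
  have "f absolutely_integrable_on (phi ` {0<..<1}) \<and> integral (phi ` {0<..<1}) f = (LINT u|lborel. f u)"
    using leb lebesgue_integral_eq_integral[of UNIV f] integral_completion[of f lborel]
    by (simp add: range_phi set_integrable_def lebesgue_on_UNIV_eq)
  then have *: "(\<lambda>x. \<bar>weight x\<bar> * f (phi x)) absolutely_integrable_on {0<..<1}"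
    "integral {0<..<1} (\<lambda>x. \<bar>weight x\<bar> * f (phi x)) = (LINT u|lborel. f u)"
    using has_absolute_integral_change_of_variables_1'[of "{0<..<1}" phi weight f "LINT u|lborel. f u"]
      has_real_derivative_phi inj_on_phi by (auto intro: has_field_derivative_at_within)
  have cong: "\<bar>weight x\<bar> * f (phi x) = weight x *\<^sub>R f (phi x)" if "x \<in> {0<..<1}" for x
    using weight_pos[OF that] by simp
  have int: "integrable lebesgue01 (\<lambda>x. \<bar>weight x\<bar> * f (phi x))"
    using *(1) by (simp add: set_integrable_def integrable_restrict_space)
  then show "integrable weighted01 (\<lambda>x. f (phi x))"
    unfolding weighted01_integrable_iff[OF fphi]
    using cong by (subst (asm) Bochner_Integration.integrable_cong[OF refl]) auto
  have "(LINT x|weighted01. f (phi x)) = (LINT x|lebesgue01. weight x *\<^sub>R f (phi x))"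
    by (rule weighted01_integral[OF fphi])
  also have "\<dots> = (LINT x|lebesgue01. \<bar>weight x\<bar> * f (phi x))"
    by (rule Bochner_Integration.integral_cong[OF refl]) (simp add: cong)
  also have "\<dots> = (LINT u|lborel. f u)"
    using lebesgue_integral_eq_integral[OF int] *(2) by simp
  finally show "(LINT x|weighted01. f (phi x)) = (LINT u|lborel. f u)" .
qed

lemma trans_hermite_fun_borel [measurable]: "trans_hermite_fun \<alpha> n \<in> borel_measurable borel"
  unfolding trans_hermite_fun_def[abs_def] gen_hermite_fun_def by measurable

lemma trans_hermite_orthonormal:
  assumes "\<alpha> > 0"
  shows "orthonormal weighted01 (trans_hermite_fun \<alpha>)"
proof -
  let ?f = "\<lambda>m n u. \<alpha> * (hermite_fun m (0 + \<alpha> * u) * hermite_fun n (0 + \<alpha> * u))"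
  have prod: "trans_hermite_fun \<alpha> m x * trans_hermite_fun \<alpha> n x = ?f m n (phi x)" for m n x
    using assms by (simp add: trans_hermite_fun_def gen_hermite_fun_def)
  have int: "integrable lborel (?f m n)" for m n
    using assms by (intro integrable_mult_right lborel_integrable_real_affine hermite_fun_orthonormal) simp
  have "(LINT u|lborel. ?f m n u) = (LINT u|lborel. hermite_fun m u * hermite_fun n u)" for m n
    using lborel_integral_real_affine[of \<alpha> "\<lambda>u. hermite_fun m u * hermite_fun n u" 0] assms
    by simp
  then have ip: "(LINT x|weighted01. trans_hermite_fun \<alpha> m x * trans_hermite_fun \<alpha> n x) = (if m = n then 1 else 0)" for m n
    unfolding prod weighted01_integral_phi(2)[OF int] by (simp add: hermite_fun_orthonormal)
  have "square_integrable weighted01 (trans_hermite_fun \<alpha> k)" for k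
  proof (rule square_integrableI)
    show "trans_hermite_fun \<alpha> k \<in> borel_measurable weighted01"
      using borel_measurable_lebesgue01[OF trans_hermite_fun_borel] by (simp add: weighted01_def)
    show "integrable weighted01 (\<lambda>x. (norm (trans_hermite_fun \<alpha> k x))\<^sup>2)"
      using weighted01_integral_phi(1)[OF int[of k k]] by (simp only: prod[symmetric] power2_eq_square real_norm_def abs_mult_self_eq)
  qed
  with ip show ?thesis by (simp add: orthonormal_def)
qed

lemma hermite_coeff_eq:
  assumes "square_integrable weighted01 g"
  shows "hermite_coeff \<alpha> g n = (LINT x|weighted01. of_real (trans_hermite_fun \<alpha> n x) * g x)"
proof -
  have [measurable]: "g \<in> borel_measurable lebesgue01"
    using square_integrableD(1)[OF assms] by (simp add: weighted01_def)
  have [measurable]: "trans_hermite_fun \<alpha> n \<in> borel_measurable lebesgue01"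
    by (rule borel_measurable_lebesgue01) measurable
  have "(LINT x|weighted01. of_real (trans_hermite_fun \<alpha> n x) * g x) =
      (LINT x|lebesgue01. weight x *\<^sub>R (of_real (trans_hermite_fun \<alpha> n x) * g x))"
    by (rule weighted01_integral) measurable
  then show ?thesis
    by (simp add: hermite_coeff_def scaleR_conv_of_real ac_simps)
qed

text \<open>Multiplication by \<open>sqrt w\<close> is an isometry from \<open>L\<^sup>2\<^sub>w(0,1)\<close> to \<open>L\<^sup>2(0,1)\<close>, the domain of the Wiener integral.\<close>
lemma weighted01_mult_sqrt_weight:
  fixes f :: "real \<Rightarrow> real"
  shows "square_integrable weighted01 f \<Longrightarrow> square_integrable lebesgue01 (\<lambda>x. f x * sqrt (weight x))"
    and "square_integrable weighted01 f \<Longrightarrow>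
      (LINT x|lebesgue01. (f x * sqrt (weight x))\<^sup>2) = (LINT x|weighted01. (f x)\<^sup>2)"
proof -
  assume f: "square_integrable weighted01 f"
  have [measurable]: "f \<in> borel_measurable lebesgue01"
    using square_integrableD(1)[OF f] by (simp add: weighted01_def)
  have [measurable]: "weight \<in> borel_measurable lebesgue01"
    by (rule borel_measurable_lebesgue01) measurable
  have eq: "(f x * sqrt (weight x))\<^sup>2 = weight x *\<^sub>R (f x)\<^sup>2" if "x \<in> space lebesgue01" for x
    using weight_pos[of x] that by (simp add: power_mult_distrib)
  have "integrable lebesgue01 (\<lambda>x. weight x *\<^sub>R (f x)\<^sup>2)"
    using square_integrable_realD[OF f] by (subst (asm) weighted01_integrable_iff) auto
  also have "?this \<longleftrightarrow> integrable lebesgue01 (\<lambda>x. (norm (f x * sqrt (weight x)))\<^sup>2)"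
    by (rule Bochner_Integration.integrable_cong[OF refl]) (simp only: eq real_norm_def power2_abs)
  finally show "square_integrable lebesgue01 (\<lambda>x. f x * sqrt (weight x))"
    by (intro square_integrableI) measurable
  show "(LINT x|lebesgue01. (f x * sqrt (weight x))\<^sup>2) = (LINT x|weighted01. (f x)\<^sup>2)"
    by (rule trans[OF Bochner_Integration.integral_cong[OF refl eq] weighted01_integral[symmetric]]) measurable
qed

text \<open>The coefficients of \<open>g\<close> are square summable, and the factors by which the kernel multiplies them are
  bounded in \<open>k\<close>.\<close>
lemma fourier_kernel_converges:
  assumes "\<alpha> > 0" and g: "square_integrable weighted01 g"
  shows "L2_tendsto weighted01 (fourier_kernel_partial \<alpha> g t) (fourier_kernel \<alpha> g t)"
proof -
  note ortho = trans_hermite_orthonormal[OF assms(1)]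
  obtain C where C: "\<And>n. (hermite_fun n (phi t / \<alpha>))\<^sup>2 \<le> C"
    using hermite_fun_bounded_in_index by blast
  have "norm (hermite_eigenvalue k) = 1" for k
    by (simp add: hermite_eigenvalue_def norm_exp_eq_Re)
  then have F_sq: "(norm (fourier_trans_hermite_fun \<alpha> k t))\<^sup>2 \<le> C / \<alpha>" for k
    using C[of k] assms(1)
    by (simp add: fourier_trans_hermite_fun_def norm_mult norm_divide power_mult_distrib power_divide divide_right_mono)
  define a where "a k = hermite_coeff \<alpha> g k * fourier_trans_hermite_fun \<alpha> k t" for k
  have "summable (\<lambda>k. (norm (hermite_coeff \<alpha> g k))\<^sup>2 * (C / \<alpha>))"
    unfolding hermite_coeff_eq[OF g] by (intro summable_mult2 summable_fourier_coefficients ortho g)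
  then have "summable (\<lambda>k. (norm (a k))\<^sup>2)"
    by (rule summable_comparison_test[rotated])
       (auto simp: a_def norm_mult power_mult_distrib simp del: times_divide_eq_right intro!: exI[of _ 0] mult_left_mono F_sq)
  from Riesz_Fischer[OF ortho this]
  obtain F where "L2_tendsto weighted01 (\<lambda>n x. \<Sum>k<n. a k * of_real (trans_hermite_fun \<alpha> k x)) F"
    by blast
  then have "L2_tendsto weighted01 (fourier_kernel_partial \<alpha> g t) F"
    by (simp add: fourier_kernel_partial_def[abs_def] a_def ac_simps)
  then show ?thesis
    unfolding fourier_kernel_def by (rule someI[where P = "L2_tendsto weighted01 (fourier_kernel_partial \<alpha> g t)"])
qed


section \<open>Density of step functions\<close>

lemma finite_measure_lebesgue01: "finite_measure lebesgue01"
  by (intro finite_measure_lebesgue_on) auto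

lemma step_fun_Nil [simp]: "step_fun [] s = 0"
  by (simp add: step_fun_def)

lemma step_fun_Cons [simp]: "step_fun ((a, l, r) # p) s = a * indicator {l<..r} s + step_fun p s"
  by (simp add: step_fun_def)

lemma step_fun_append [simp]: "step_fun (p @ q) s = step_fun p s + step_fun q s"
  by (simp add: step_fun_def)

text \<open>Scales the step function and its integral by \<open>b\<close>; with concatenation as addition, this makes both
  linear in the representation.\<close>
definition scale_step :: "real \<Rightarrow> step_rep \<Rightarrow> step_rep" where
  "scale_step b p = map (\<lambda>(a, l, r). (b * a, l, r)) p"

lemma step_fun_scale [simp]: "step_fun (scale_step b p) s = b * step_fun p s"
  by (induction p) (auto simp: scale_step_def step_fun_def algebra_simps)

lemma step_rep01_Nil [simp]: "step_rep01 []"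
  by (simp add: step_rep01_def)

lemma step_rep01_Cons [simp]: "step_rep01 ((a, l, r) # p) \<longleftrightarrow> 0 \<le> l \<and> l \<le> r \<and> r \<le> 1 \<and> step_rep01 p"
  by (auto simp: step_rep01_def)

lemma step_rep01_append [simp]: "step_rep01 (p @ q) \<longleftrightarrow> step_rep01 p \<and> step_rep01 q"
  by (simp add: step_rep01_def ball_Un)

lemma step_rep01_scale [simp]: "step_rep01 (scale_step b p) \<longleftrightarrow> step_rep01 p"
  by (induction p) (auto simp: scale_step_def step_rep01_def)

lemma indicator_measurable_lebesgue01:
  "A \<in> sets lebesgue \<Longrightarrow> indicat_real A \<in> borel_measurable lebesgue01"
  by (intro measurable_restrict_space1 borel_measurable_indicator)

lemma square_integrable_indicator_lebesgue01:
  assumes "A \<in> sets lebesgue"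
  shows "square_integrable lebesgue01 (indicat_real A)"
proof (rule square_integrable_dominated[OF indicator_measurable_lebesgue01[OF assms]])
  interpret finite_measure lebesgue01 by (rule finite_measure_lebesgue01)
  show "square_integrable lebesgue01 (\<lambda>x. 1 :: real)"
    by (simp add: square_integrable_def)
qed (simp add: indicator_def)

lemma square_integrable_step_fun: "square_integrable lebesgue01 (step_fun p)"
proof (induction p)
  case (Cons x p)
  obtain a l r where x: "x = (a, l, r)" by (cases x)
  have "square_integrable lebesgue01 (\<lambda>s. a * indicator {l<..r} s + step_fun p s)"
    by (intro square_integrable_add square_integrable_cmult square_integrable_indicator_lebesgue01 Cons.IH) simp
  then show ?case by (simp add: x step_fun_Cons[abs_def])
qed (simp add: step_fun_Nil[abs_def])

definition step_approximable :: "(real \<Rightarrow> real) \<Rightarrow> bool" where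
  "step_approximable f \<longleftrightarrow>
     (\<exists>p. (\<forall>k. step_rep01 (p k)) \<and> L2_tendsto lebesgue01 (\<lambda>k. step_fun (p k)) f)"

lemma step_approximable_add:
  assumes "step_approximable f" "step_approximable g"
  shows "step_approximable (\<lambda>s. f s + g s)"
proof -
  obtain p q where "\<forall>k. step_rep01 (p k)" "L2_tendsto lebesgue01 (\<lambda>k. step_fun (p k)) f"
    "\<forall>k. step_rep01 (q k)" "L2_tendsto lebesgue01 (\<lambda>k. step_fun (q k)) g"
    using assms by (auto simp: step_approximable_def)
  then show ?thesis
    unfolding step_approximable_def
    by (intro exI[of _ "\<lambda>k. p k @ q k"]) (use L2_tendsto_add in \<open>auto simp: step_fun_append[abs_def]\<close>)
qed

lemma step_approximable_cmult:
  assumes "step_approximable f"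
  shows "step_approximable (\<lambda>s. b * f s)"
proof -
  obtain p where "\<forall>k. step_rep01 (p k)" "L2_tendsto lebesgue01 (\<lambda>k. step_fun (p k)) f"
    using assms by (auto simp: step_approximable_def)
  then show ?thesis
    unfolding step_approximable_def
    by (intro exI[of _ "\<lambda>k. scale_step b (p k)"]) (use L2_tendsto_cmult in \<open>auto simp: step_fun_scale[abs_def]\<close>)
qed

lemma step_approximable_step_fun: "step_rep01 p \<Longrightarrow> step_approximable (step_fun p)"
  unfolding step_approximable_def
  by (intro exI[of _ "\<lambda>k. p"]) (simp add: L2_tendsto_const square_integrable_step_fun)

lemma step_approximable_sum:
  assumes "\<And>i. i \<in> I \<Longrightarrow> step_approximable (f i)"
  shows "step_approximable (\<lambda>s. \<Sum>i\<in>I. f i s)"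
proof -
  have zero: "step_approximable (\<lambda>s. 0)"
    using step_approximable_step_fun[of "[]"] by (simp add: step_fun_Nil[abs_def])
  show ?thesis
    using assms by (induction I rule: infinite_finite_induct) (auto simp: zero intro: step_approximable_add)
qed

lemma step_approximable_cong_AE:
  assumes "step_approximable f" "g \<in> borel_measurable lebesgue01" "AE x in lebesgue01. f x = g x"
  shows "step_approximable g"
  using assms L2_tendsto_cong_AE unfolding step_approximable_def by blast

lemma step_approximable_cong:
  assumes "step_approximable f" "\<And>s. s \<in> {0<..<1} \<Longrightarrow> f s = g s"
  shows "step_approximable g"
proof (rule step_approximable_cong_AE[OF assms(1)])
  have "f \<in> borel_measurable lebesgue01"
    using assms(1) by (auto simp: step_approximable_def dest: L2_tendstoD(2))
  then show "g \<in> borel_measurable lebesgue01"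
    by (rule measurable_cong[THEN iffD1, rotated]) (simp add: assms(2))
qed (auto intro!: AE_I2 assms(2))

text \<open>A diagonal choice: approximate the \<open>n\<close>-th function to within \<open>1/(n+1)\<close>.\<close>
lemma step_approximable_L2_limit:
  assumes F: "\<And>n. step_approximable (F n)" and lim: "L2_tendsto lebesgue01 F f"
  shows "step_approximable f"
proof -
  have "\<exists>p. step_rep01 p \<and> (LINT s|lebesgue01. (norm (step_fun p s - F n s))\<^sup>2) < inverse (real (Suc n))" for n
  proof -
    obtain p where p: "\<And>k. step_rep01 (p k)" "L2_tendsto lebesgue01 (\<lambda>k. step_fun (p k)) (F n)"
      using F by (auto simp: step_approximable_def)
    have "\<forall>\<^sub>F k in sequentially. (LINT s|lebesgue01. (norm (step_fun (p k) s - F n s))\<^sup>2) < inverse (real (Suc n))"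
      by (rule order_tendstoD(2)[OF L2_tendstoD(3)[OF p(2)]]) simp
    then show ?thesis using p(1) by (auto dest!: eventually_happens)
  qed
  then obtain p where p: "\<And>n. step_rep01 (p n)"
    "\<And>n. (LINT s|lebesgue01. (norm (step_fun (p n) s - F n s))\<^sup>2) < inverse (real (Suc n))"
    by metis
  note Ff = L2_tendstoD[OF lim]
  have "L2_tendsto lebesgue01 (\<lambda>n s. (step_fun (p n) s - F n s) + F n s) (\<lambda>s. 0 + f s)"
  proof (rule L2_tendsto_add[OF L2_tendstoI lim])
    show "square_integrable lebesgue01 (\<lambda>s. step_fun (p n) s - F n s)" for n
      by (intro square_integrable_diff square_integrable_step_fun Ff)
    show "(\<lambda>n. LINT s|lebesgue01. (norm (step_fun (p n) s - F n s - 0))\<^sup>2) \<longlonglongrightarrow> 0"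
      using p(2) by (intro tendsto_sandwich[OF _ _ tendsto_const LIMSEQ_inverse_real_of_nat] always_eventually)
        (auto intro: less_imp_le)
  qed simp
  then show ?thesis
    unfolding step_approximable_def using p(1) by (intro exI[of _ p]) simp
qed

text \<open>Half-open intervals form an intersection-stable generator of the Borel sets, and approximability of the
  indicator is stable under complements and countable disjoint unions.\<close>
lemma step_approximable_indicator_borel:
  fixes A :: "real set"
  assumes "A \<in> sets borel"
  shows "step_approximable (indicator A)"
proof -
  let ?G = "range (\<lambda>(a, b). {a<..b::real})"
  interpret finite_measure lebesgue01 by (rule finite_measure_lebesgue01)
  have sets: "sets borel = sigma_sets UNIV ?G"
    by (subst borel_sigma_sets_Ioc) (rule sets_measure_of, simp)
  have stable: "Int_stable ?G"
  proof (rule Int_stableI)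
    fix X Y assume "X \<in> ?G" "Y \<in> ?G"
    then obtain a b a' b' where "X = {a<..b}" "Y = {a'<..b'}" by auto
    then have "X \<inter> Y = {max a a'<..min b b'}" by auto
    then show "X \<inter> Y \<in> ?G" by auto
  qed
  have "A \<in> sigma_sets UNIV ?G" using assms sets by simp
  with stable subset_UNIV[of ?G, folded Pow_UNIV] show ?thesis
  proof (induction rule: sigma_sets_induct_disjoint)
    case (basic A)
    then obtain a b where A: "A = {a<..b}" by auto
    \<comment> \<open>The part of \<open>(a, b]\<close> in \<open>(0, 1)\<close>, written with end points in \<open>[0, 1]\<close>; \<open>r = l\<close> if it is empty.\<close>
    define l where "l = min 1 (max 0 a)"
    define r where "r = max l (min 1 b)"
    have "step_approximable (step_fun [(1, l, r)])"
      by (rule step_approximable_step_fun) (auto simp: l_def r_def)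
    then show ?case
      by (rule step_approximable_cong) (auto simp: A l_def r_def indicator_def)
  next
    case empty
    show ?case
      by (rule step_approximable_cong[OF step_approximable_step_fun[of "[]"]]) auto
  next
    case (compl A)
    have "step_approximable (\<lambda>s. step_fun [(1, 0, 1)] s + (-1) * indicator A s)"
      by (intro step_approximable_add step_approximable_cmult step_approximable_step_fun compl) simp
    then show ?case
      by (rule step_approximable_cong) (auto simp: indicator_def)
  next
    case (union A)
    have A: "A i \<in> sets lebesgue" for i
      using union(2) sets by (intro sets_completionI_sets) (auto simp: image_subset_iff)
    have sum_eq: "(\<Sum>i<n. indicat_real (A i) x) = indicator (\<Union>i<n. A i) x" for n x
      using union(1) by (intro indicator_UN_disjoint[symmetric]) (auto simp: disjoint_family_on_def)
    have "step_approximable (\<lambda>x. \<Sum>i<n. indicator (A i) x)" for n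
      by (intro step_approximable_sum union)
    then have appr: "step_approximable (indicator (\<Union>i<n. A i))" for n
      unfolding sum_eq .
    show ?case
    proof (rule step_approximable_L2_limit[OF appr L2_tendsto_dominated])
      show "square_integrable lebesgue01 (\<lambda>x. 1 :: real)"
        by (simp add: square_integrable_def)
      show "indicat_real (\<Union>i<n. A i) \<in> borel_measurable lebesgue01" for n
        using A by (intro indicator_measurable_lebesgue01) auto
      show "indicat_real (\<Union>i. A i) \<in> borel_measurable lebesgue01"
        using A by (intro indicator_measurable_lebesgue01) auto
      show "(\<lambda>n. indicat_real (\<Union>i<n. A i) x) \<longlonglongrightarrow> indicator (\<Union>i. A i) x" for x
        by (rule LIMSEQ_indicator_UN)
    qed (simp add: indicator_def)
  qed
qed

text \<open>A Lebesgue set differs from a Borel set by a null set.\<close>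
lemma step_approximable_indicator_lebesgue:
  assumes "A \<in> sets lebesgue"
  shows "step_approximable (indicator A)"
proof -
  obtain S K K' where A: "A = S \<union> K" "K \<subseteq> K'" "K' \<in> null_sets lborel" "S \<in> sets borel"
    using sets_completionE[OF assms] by (metis sets_lborel)
  have "AE x in lborel. x \<notin> K'" using A(3) by (rule AE_not_in)
  then have "AE x in lebesgue. x \<notin> K'" by (rule AE_completion)
  then have "AE x in lebesgue01. x \<notin> K'" by (simp add: AE_restrict_space_iff) (auto elim: eventually_mono)
  then have "AE x in lebesgue01. indicat_real S x = indicator A x"
    by eventually_elim (use A in \<open>auto simp: indicator_def\<close>)
  then show ?thesis
    using step_approximable_indicator_borel[OF A(4)] indicator_measurable_lebesgue01[OF assms]
    by (rule step_approximable_cong_AE[rotated 2])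
qed

text \<open>Simple functions bounded by \<open>2 |f|\<close> converge to \<open>f\<close> pointwise and hence, by domination, in \<open>L\<^sup>2\<close>; each
  is a finite combination of indicators.\<close>
theorem square_integrable_step_approximable:
  assumes f: "square_integrable lebesgue01 f"
  shows "step_approximable f"
proof -
  from borel_measurable_implies_sequence_metric[OF square_integrableD(1)[OF f], of 0, unfolded dist_real_def diff_0_right]
  obtain F where F: "\<And>i. simple_function lebesgue01 (F i)"
    "\<And>x. x \<in> space lebesgue01 \<Longrightarrow> (\<lambda>i. F i x) \<longlonglongrightarrow> f x"
    "\<And>i x. x \<in> space lebesgue01 \<Longrightarrow> \<bar>F i x\<bar> \<le> 2 * \<bar>f x\<bar>"
    by blast
  have appr: "step_approximable (F i)" for i
  proof -
    note fin = simple_functionD(1)[OF F(1)[of i]]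
    have "F i -` {y} \<inter> {0<..<1} \<in> sets lebesgue" for y
      using simple_functionD(2)[OF F(1)[of i], of "{y}"] by (simp add: sets_restrict_space_iff)
    then have "step_approximable (\<lambda>s. \<Sum>y\<in>F i ` {0<..<1}. y * indicator (F i -` {y} \<inter> {0<..<1}) s)"
      by (intro step_approximable_sum step_approximable_cmult step_approximable_indicator_lebesgue)
    then show ?thesis
    proof (rule step_approximable_cong)
      fix s :: real assume s: "s \<in> {0<..<1}"
      have "(\<Sum>y\<in>F i ` {0<..<1}. y * indicator (F i -` {y} \<inter> {0<..<1}) s) =
          (\<Sum>y\<in>F i ` {0<..<1}. if y = F i s then y else 0)"
        using s by (intro sum.cong) (auto simp: indicator_def)
      also have "\<dots> = F i s" using fin s by simp
      finally show "(\<Sum>y\<in>F i ` {0<..<1}. y * indicator (F i -` {y} \<inter> {0<..<1}) s) = F i s" .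
    qed
  qed
  have "L2_tendsto lebesgue01 F f"
    by (rule L2_tendsto_dominated[where g = "\<lambda>x. 2 * f x"])
       (use F f square_integrable_cmult[OF f, of 2] in
        \<open>auto simp: abs_mult intro: borel_measurable_simple_function\<close>)
  then show ?thesis
    by (rule step_approximable_L2_limit[OF appr])
qed


section \<open>The Wiener integral\<close>

lemma integral_indicator_Ioc_lebesgue01:
  assumes "0 \<le> a" "b \<le> 1"
  shows "(LINT s|lebesgue01. indicator {a<..b} s) = max 0 (b - a)"
proof -
  have "(LINT s|lebesgue01. indicator {a<..b} s) = measure lebesgue ({a<..b} \<inter> {0<..<1})"
    by (simp add: measure_restrict_space)
  also have "\<dots> = max 0 (b - a)"
  proof (cases "a < b")
    case True
    have "{a<..b} \<inter> {0<..<1} = (if b = 1 then {a<..<b} else {a<..b})"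
      using assms by auto
    with True show ?thesis by simp
  qed simp
  finally show ?thesis .
qed

text \<open>The length of the overlap of two intervals, in the form in which the covariance of two increments
  appears.\<close>
lemma integral_indicator_Ioc_mult:
  assumes "0 \<le> l" "l \<le> r" "r \<le> 1" "0 \<le> l'" "l' \<le> r'" "r' \<le> 1"
  shows "(LINT s|lebesgue01. indicator {l<..r} s * indicator {l'<..r'} s) =
    (\<bar>r - l'\<bar> + \<bar>l - r'\<bar> - \<bar>r - r'\<bar> - \<bar>l - l'\<bar>) / 2"
proof -
  have "indicat_real {l<..r} s * indicator {l'<..r'} s = indicator {max l l'<..min r r'} s" for s
    by (auto simp: indicator_def)
  then have "(LINT s|lebesgue01. indicat_real {l<..r} s * indicator {l'<..r'} s) = max 0 (min r r' - max l l')"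
    using integral_indicator_Ioc_lebesgue01[of "max l l'" "min r r'"] assms by simp
  also have "\<dots> = (\<bar>r - l'\<bar> + \<bar>l - r'\<bar> - \<bar>r - r'\<bar> - \<bar>l - l'\<bar>) / 2"
    using assms by (auto simp: max_def min_def abs_if)
  finally show ?thesis .
qed

lemma step_integral_Nil [simp]: "step_integral W [] \<omega> = 0"
  by (simp add: step_integral_def)

lemma step_integral_Cons [simp]:
  "step_integral W ((a, l, r) # p) \<omega> = a * (W r \<omega> - W l \<omega>) + step_integral W p \<omega>"
  by (simp add: step_integral_def)

lemma step_integral_append [simp]:
  "step_integral W (p @ q) \<omega> = step_integral W p \<omega> + step_integral W q \<omega>"
  by (simp add: step_integral_def)

lemma step_integral_scale [simp]: "step_integral W (scale_step b p) \<omega> = b * step_integral W p \<omega>"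
  by (induction p) (auto simp: scale_step_def step_integral_def algebra_simps)

text \<open>Linearity is stated for the relation and not for the selected version of the integral, for which it
  holds only almost everywhere.\<close>
lemma has_wiener_integral_add:
  assumes "has_wiener_integral M W f J" "has_wiener_integral M W f' J'"
  shows "has_wiener_integral M W (\<lambda>s. f s + f' s) (\<lambda>\<omega>. J \<omega> + J' \<omega>)"
proof -
  obtain p q where p: "\<And>k. step_rep01 (p k)" "L2_tendsto lebesgue01 (\<lambda>k. step_fun (p k)) f"
    "L2_tendsto M (\<lambda>k. step_integral W (p k)) J"
    and q: "\<And>k. step_rep01 (q k)" "L2_tendsto lebesgue01 (\<lambda>k. step_fun (q k)) f'"
    "L2_tendsto M (\<lambda>k. step_integral W (q k)) J'"
    using assms by (auto simp: has_wiener_integral_def)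
  from L2_tendsto_add[OF p(2) q(2)] L2_tendsto_add[OF p(3) q(3)] p(1) q(1) show ?thesis
    unfolding has_wiener_integral_def
    by (intro exI[of _ "\<lambda>k. p k @ q k"]) (simp add: step_fun_append[abs_def] step_integral_append[abs_def])
qed

lemma has_wiener_integral_cmult:
  assumes "has_wiener_integral M W f J"
  shows "has_wiener_integral M W (\<lambda>s. b * f s) (\<lambda>\<omega>. b * J \<omega>)"
proof -
  obtain p where p: "\<And>k. step_rep01 (p k)" "L2_tendsto lebesgue01 (\<lambda>k. step_fun (p k)) f"
    "L2_tendsto M (\<lambda>k. step_integral W (p k)) J"
    using assms by (auto simp: has_wiener_integral_def)
  from L2_tendsto_cmult[OF p(2), of b] L2_tendsto_cmult[OF p(3), of b] p(1) show ?thesis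
    unfolding has_wiener_integral_def
    by (intro exI[of _ "\<lambda>k. scale_step b (p k)"]) (simp add: step_fun_scale[abs_def] step_integral_scale[abs_def])
qed

lemma has_wiener_integral_zero: "has_wiener_integral M W (\<lambda>s. 0) (\<lambda>\<omega>. 0)"
  unfolding has_wiener_integral_def
  by (intro exI[of _ "\<lambda>k. []"]) (simp add: L2_tendsto_const step_fun_Nil[abs_def] step_integral_Nil[abs_def])

lemma has_wiener_integral_sum:
  assumes "\<And>i. i \<in> I \<Longrightarrow> has_wiener_integral M W (f i) (J i)"
  shows "has_wiener_integral M W (\<lambda>s. \<Sum>i\<in>I. f i s) (\<lambda>\<omega>. \<Sum>i\<in>I. J i \<omega>)"
  using assms
  by (induction I rule: infinite_finite_induct) (auto intro: has_wiener_integral_add has_wiener_integral_zero)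

lemma has_wiener_integral_diff:
  assumes "has_wiener_integral M W f J" "has_wiener_integral M W f' J'"
  shows "has_wiener_integral M W (\<lambda>s. f s - f' s) (\<lambda>\<omega>. J \<omega> - J' \<omega>)"
  using has_wiener_integral_add[OF assms(1) has_wiener_integral_cmult[OF assms(2), of "-1"]] by simp

lemma has_wiener_integral_square_integrable:
  assumes "has_wiener_integral M W f J"
  shows "square_integrable M J"
  using assms by (auto simp: has_wiener_integral_def dest: L2_tendstoD(2))

context wiener_process
begin

lemma increment_second_moment:
  assumes "0 \<le> s" "s \<le> t"
  shows "square_integrable M (\<lambda>\<omega>. W t \<omega> - W s \<omega>)"
    and "expectation (\<lambda>\<omega>. (W t \<omega> - W s \<omega>)\<^sup>2) = c\<^sup>2 * (t - s)"
proof -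
  have [measurable]: "W t \<in> borel_measurable M" "W s \<in> borel_measurable M"
    using measurable_W assms by auto
  have "square_integrable M (\<lambda>\<omega>. W t \<omega> - W s \<omega>) \<and> expectation (\<lambda>\<omega>. (W t \<omega> - W s \<omega>)\<^sup>2) = c\<^sup>2 * (t - s)"
  proof (cases "s = t")
    case False
    with assms have "s < t" by simp
    define \<sigma> where "\<sigma> = c * sqrt (t - s)"
    have \<sigma>: "\<sigma> > 0" using c_pos \<open>s < t\<close> by (simp add: \<sigma>_def)
    have D: "distributed M lborel (\<lambda>\<omega>. W t \<omega> - W s \<omega>) (normal_density 0 \<sigma>)"
      unfolding \<sigma>_def by (rule normal_increments[OF assms(1) \<open>s < t\<close>])
    have "integrable lborel (\<lambda>x. normal_density 0 \<sigma> x * x\<^sup>2)"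
      using integrable_normal_moment[OF \<sigma>, of 0 2] by simp
    then have "integrable M (\<lambda>\<omega>. (W t \<omega> - W s \<omega>)\<^sup>2)"
      by (subst (asm) distributed_integrable[OF D]) auto
    moreover have "expectation (\<lambda>\<omega>. (W t \<omega> - W s \<omega>)\<^sup>2) = (LINT x|lborel. normal_density 0 \<sigma> x * x\<^sup>2)"
      by (rule distributed_integral[OF D, symmetric]) auto
    moreover have "(LINT x|lborel. normal_density 0 \<sigma> x * x\<^sup>2) = \<sigma>\<^sup>2"
      using integral_normal_moment_even[OF \<sigma>, of 0 1] by (simp add: fact_2)
    moreover have "\<sigma>\<^sup>2 = c\<^sup>2 * (t - s)"
      using \<open>s < t\<close> by (simp add: \<sigma>_def power_mult_distrib)
    ultimately show ?thesis by (auto intro!: square_integrableI)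
  qed simp
  then show "square_integrable M (\<lambda>\<omega>. W t \<omega> - W s \<omega>)"
    and "expectation (\<lambda>\<omega>. (W t \<omega> - W s \<omega>)\<^sup>2) = c\<^sup>2 * (t - s)" by auto
qed

lemma difference_second_moment:
  assumes "0 \<le> s" "0 \<le> t"
  shows "square_integrable M (\<lambda>\<omega>. W t \<omega> - W s \<omega>)"
    and "expectation (\<lambda>\<omega>. (W t \<omega> - W s \<omega>)\<^sup>2) = c\<^sup>2 * \<bar>t - s\<bar>"
proof -
  have "square_integrable M (\<lambda>\<omega>. W t \<omega> - W s \<omega>) \<and> expectation (\<lambda>\<omega>. (W t \<omega> - W s \<omega>)\<^sup>2) = c\<^sup>2 * \<bar>t - s\<bar>"
  proof (cases "s \<le> t")
    case True
    then show ?thesis using increment_second_moment[OF assms(1) True] by simp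
  next
    case False
    then have "t \<le> s" by simp
    from increment_second_moment[OF assms(2) this] square_integrable_cmult[OF increment_second_moment(1)[OF assms(2) this], of "-1"]
    show ?thesis using False by (simp add: power2_commute)
  qed
  then show "square_integrable M (\<lambda>\<omega>. W t \<omega> - W s \<omega>)"
    and "expectation (\<lambda>\<omega>. (W t \<omega> - W s \<omega>)\<^sup>2) = c\<^sup>2 * \<bar>t - s\<bar>" by auto
qed

text \<open>Polarization: \<open>2 (r - l) (r' - l') = (r - l')\<^sup>2 + (l - r')\<^sup>2 - (r - r')\<^sup>2 - (l - l')\<^sup>2\<close>, applied to the values
  of \<open>W\<close>.\<close>
lemma increment_covariance:
  assumes "0 \<le> l" "0 \<le> r" "0 \<le> l'" "0 \<le> r'"
  shows "expectation (\<lambda>\<omega>. (W r \<omega> - W l \<omega>) * (W r' \<omega> - W l' \<omega>)) =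
    c\<^sup>2 * ((\<bar>r - l'\<bar> + \<bar>l - r'\<bar> - \<bar>r - r'\<bar> - \<bar>l - l'\<bar>) / 2)"
proof -
  have "(\<lambda>\<omega>. (W r \<omega> - W l \<omega>) * (W r' \<omega> - W l' \<omega>)) =
      (\<lambda>\<omega>. ((W r \<omega> - W l' \<omega>)\<^sup>2 + (W l \<omega> - W r' \<omega>)\<^sup>2 - (W r \<omega> - W r' \<omega>)\<^sup>2 - (W l \<omega> - W l' \<omega>)\<^sup>2) / 2)"
    by (auto simp: power2_eq_square algebra_simps)
  then show ?thesis
    using assms difference_second_moment
    by (simp add: square_integrable_realD[OF difference_second_moment(1)] algebra_simps)
qed

lemma square_integrable_step_integral:
  "step_rep01 p \<Longrightarrow> square_integrable M (step_integral W p)"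
proof (induction p)
  case (Cons x p)
  obtain a l r where x: "x = (a, l, r)" by (cases x)
  have "square_integrable M (\<lambda>\<omega>. a * (W r \<omega> - W l \<omega>) + step_integral W p \<omega>)"
    using Cons by (intro square_integrable_add square_integrable_cmult increment_second_moment) (auto simp: x)
  then show ?case by (simp add: x step_integral_Cons[abs_def])
qed (simp add: step_integral_Nil[abs_def])

text \<open>Together with the next lemma this extends the covariance of increments bilinearly to step integrals, one
  argument at a time.\<close>
lemma step_integral_increment_covariance:
  assumes "0 \<le> l" "l \<le> r" "r \<le> 1" "step_rep01 q"
  shows "expectation (\<lambda>\<omega>. (W r \<omega> - W l \<omega>) * step_integral W q \<omega>) =
    c\<^sup>2 * (LINT s|lebesgue01. indicator {l<..r} s * step_fun q s)"
  using assms(4)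
proof (induction q)
  case (Cons x q)
  obtain a l' r' where x: "x = (a, l', r')" by (cases x)
  with Cons.prems have q: "0 \<le> l'" "l' \<le> r'" "r' \<le> 1" "step_rep01 q" by auto
  have W1: "integrable M (\<lambda>\<omega>. (W r \<omega> - W l \<omega>) * (W r' \<omega> - W l' \<omega>))"
    using assms q by (intro square_integrable_mult_integrable increment_second_moment) auto
  have W2: "integrable M (\<lambda>\<omega>. (W r \<omega> - W l \<omega>) * step_integral W q \<omega>)"
    using assms q by (intro square_integrable_mult_integrable increment_second_moment square_integrable_step_integral) auto
  have L1: "integrable lebesgue01 (\<lambda>s. indicat_real {l<..r} s * indicator {l'<..r'} s)"
    by (intro square_integrable_mult_integrable square_integrable_indicator_lebesgue01) auto
  have L2: "integrable lebesgue01 (\<lambda>s. indicat_real {l<..r} s * step_fun q s)"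
    by (intro square_integrable_mult_integrable square_integrable_indicator_lebesgue01 square_integrable_step_fun) auto
  have "expectation (\<lambda>\<omega>. (W r \<omega> - W l \<omega>) * step_integral W (x # q) \<omega>) =
      expectation (\<lambda>\<omega>. a * ((W r \<omega> - W l \<omega>) * (W r' \<omega> - W l' \<omega>)) + (W r \<omega> - W l \<omega>) * step_integral W q \<omega>)"
    by (simp only: x step_integral_Cons distrib_left mult.left_commute)
  also have "\<dots> = a * expectation (\<lambda>\<omega>. (W r \<omega> - W l \<omega>) * (W r' \<omega> - W l' \<omega>)) +
      expectation (\<lambda>\<omega>. (W r \<omega> - W l \<omega>) * step_integral W q \<omega>)"
    using W1 W2 by (simp only: Bochner_Integration.integral_add integrable_mult_right integral_mult_right_zero)
  also have "\<dots> = a * (c\<^sup>2 * (LINT s|lebesgue01. indicat_real {l<..r} s * indicator {l'<..r'} s)) +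
      c\<^sup>2 * (LINT s|lebesgue01. indicator {l<..r} s * step_fun q s)"
    using assms q Cons.IH by (subst integral_indicator_Ioc_mult) (simp_all add: increment_covariance)
  also have "\<dots> = c\<^sup>2 * (a * (LINT s|lebesgue01. indicat_real {l<..r} s * indicator {l'<..r'} s) +
      (LINT s|lebesgue01. indicator {l<..r} s * step_fun q s))"
    by (simp only: distrib_left mult.left_commute)
  also have "\<dots> = c\<^sup>2 * (LINT s|lebesgue01. a * (indicat_real {l<..r} s * indicator {l'<..r'} s) +
      indicator {l<..r} s * step_fun q s)"
    using L1 L2 by (simp only: Bochner_Integration.integral_add integrable_mult_right integral_mult_right_zero)
  also have "\<dots> = c\<^sup>2 * (LINT s|lebesgue01. indicator {l<..r} s * step_fun (x # q) s)"
    by (simp only: x step_fun_Cons distrib_left mult.left_commute)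
  finally show ?case .
qed (simp add: step_integral_Nil[abs_def] step_fun_Nil[abs_def])

lemma step_integral_covariance:
  assumes "step_rep01 p" "step_rep01 q"
  shows "expectation (\<lambda>\<omega>. step_integral W p \<omega> * step_integral W q \<omega>) =
    c\<^sup>2 * (LINT s|lebesgue01. step_fun p s * step_fun q s)"
  using assms(1)
proof (induction p)
  case (Cons x p)
  obtain a l r where x: "x = (a, l, r)" by (cases x)
  with Cons.prems have p: "0 \<le> l" "l \<le> r" "r \<le> 1" "step_rep01 p" by auto
  have W1: "integrable M (\<lambda>\<omega>. (W r \<omega> - W l \<omega>) * step_integral W q \<omega>)"
    using assms p by (intro square_integrable_mult_integrable increment_second_moment square_integrable_step_integral) auto
  have W2: "integrable M (\<lambda>\<omega>. step_integral W p \<omega> * step_integral W q \<omega>)"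
    using assms p by (intro square_integrable_mult_integrable square_integrable_step_integral) auto
  have L1: "integrable lebesgue01 (\<lambda>s. indicat_real {l<..r} s * step_fun q s)"
    by (intro square_integrable_mult_integrable square_integrable_indicator_lebesgue01 square_integrable_step_fun) auto
  have L2: "integrable lebesgue01 (\<lambda>s. step_fun p s * step_fun q s)"
    by (intro square_integrable_mult_integrable square_integrable_step_fun)
  have "expectation (\<lambda>\<omega>. step_integral W (x # p) \<omega> * step_integral W q \<omega>) =
      expectation (\<lambda>\<omega>. a * ((W r \<omega> - W l \<omega>) * step_integral W q \<omega>) + step_integral W p \<omega> * step_integral W q \<omega>)"
    by (simp only: x step_integral_Cons distrib_right mult.assoc)
  also have "\<dots> = a * expectation (\<lambda>\<omega>. (W r \<omega> - W l \<omega>) * step_integral W q \<omega>) +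
      expectation (\<lambda>\<omega>. step_integral W p \<omega> * step_integral W q \<omega>)"
    using W1 W2 by (simp only: Bochner_Integration.integral_add integrable_mult_right integral_mult_right_zero)
  also have "\<dots> = c\<^sup>2 * (a * (LINT s|lebesgue01. indicat_real {l<..r} s * step_fun q s) +
      (LINT s|lebesgue01. step_fun p s * step_fun q s))"
    unfolding step_integral_increment_covariance[OF p(1-3) assms(2)] Cons.IH[OF p(4)]
    by (simp only: distrib_left mult.left_commute)
  also have "\<dots> = c\<^sup>2 * (LINT s|lebesgue01. a * (indicat_real {l<..r} s * step_fun q s) + step_fun p s * step_fun q s)"
    using L1 L2 by (simp only: Bochner_Integration.integral_add integrable_mult_right integral_mult_right_zero)
  also have "\<dots> = c\<^sup>2 * (LINT s|lebesgue01. step_fun (x # p) s * step_fun q s)"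
    by (simp only: x step_fun_Cons distrib_right mult.assoc)
  finally show ?case .
qed (simp add: step_integral_Nil[abs_def] step_fun_Nil[abs_def])

lemma step_integral_isometry:
  assumes "step_rep01 p"
  shows "expectation (\<lambda>\<omega>. (step_integral W p \<omega>)\<^sup>2) = c\<^sup>2 * (LINT s|lebesgue01. (step_fun p s)\<^sup>2)"
  using step_integral_covariance[OF assms assms] by (simp add: power2_eq_square)

lemma wiener_isometry:
  assumes "has_wiener_integral M W f J"
  shows "expectation (\<lambda>\<omega>. (J \<omega>)\<^sup>2) = c\<^sup>2 * (LINT s|lebesgue01. (f s)\<^sup>2)"
proof -
  obtain p where p: "\<And>k. step_rep01 (p k)" "L2_tendsto lebesgue01 (\<lambda>k. step_fun (p k)) f"
    "L2_tendsto M (\<lambda>k. step_integral W (p k)) J"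
    using assms by (auto simp: has_wiener_integral_def)
  have "(\<lambda>k. expectation (\<lambda>\<omega>. (step_integral W (p k) \<omega>)\<^sup>2)) \<longlonglongrightarrow> expectation (\<lambda>\<omega>. (J \<omega>)\<^sup>2)"
    by (rule L2_tendsto_integral_square[OF p(3)])
  moreover have "(\<lambda>k. expectation (\<lambda>\<omega>. (step_integral W (p k) \<omega>)\<^sup>2)) \<longlonglongrightarrow> c\<^sup>2 * (LINT s|lebesgue01. (f s)\<^sup>2)"
    unfolding step_integral_isometry[OF p(1)]
    by (intro tendsto_mult_left L2_tendsto_integral_square[OF p(2)])
  ultimately show ?thesis by (rule LIMSEQ_unique)
qed

text \<open>The isometry makes the integrals of approximating step functions a Cauchy sequence.\<close>
lemma has_wiener_integral_wiener_integral:
  assumes f: "square_integrable lebesgue01 f"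
  shows "has_wiener_integral M W f (wiener_integral M W f)"
proof -
  obtain p where p: "\<And>k. step_rep01 (p k)" and lim: "L2_tendsto lebesgue01 (\<lambda>k. step_fun (p k)) f"
    using square_integrable_step_approximable[OF f] by (auto simp: step_approximable_def)
  have "\<exists>J. L2_tendsto M (\<lambda>k. step_integral W (p k)) J"
  proof (rule L2_complete)
    show "square_integrable M (step_integral W (p k))" for k
      by (rule square_integrable_step_integral[OF p])
    define d where "d k = (LINT s|lebesgue01. (norm (step_fun (p k) s - f s))\<^sup>2)" for k
    \<comment> \<open>The difference of two step integrals is itself the integral of a step representation.\<close>
    have le: "expectation (\<lambda>\<omega>. (norm (step_integral W (p m) \<omega> - step_integral W (p n) \<omega>))\<^sup>2) \<le> 2 * c\<^sup>2 * (d m + d n)" for m n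
    proof -
      have "expectation (\<lambda>\<omega>. (norm (step_integral W (p m) \<omega> - step_integral W (p n) \<omega>))\<^sup>2) =
          c\<^sup>2 * (LINT s|lebesgue01. (norm ((step_fun (p m) s - f s) + (f s - step_fun (p n) s)))\<^sup>2)"
        using step_integral_isometry[of "p m @ scale_step (-1) (p n)"] p by simp
      also have "\<dots> \<le> c\<^sup>2 * (2 * d m + 2 * (LINT s|lebesgue01. (norm (f s - step_fun (p n) s))\<^sup>2))"
        unfolding d_def
        by (intro mult_left_mono integral_norm_add_sq_le square_integrable_diff square_integrable_step_fun f) simp
      also have "(LINT s|lebesgue01. (norm (f s - step_fun (p n) s))\<^sup>2) = d n"
        unfolding d_def by (simp add: power2_commute)
      finally show ?thesis by (simp add: algebra_simps)
    qed
    fix e :: real assume "e > 0"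
    have "(\<lambda>k. 2 * c\<^sup>2 * d k) \<longlonglongrightarrow> 2 * c\<^sup>2 * 0"
      using L2_tendstoD(3)[OF lim] unfolding d_def by (intro tendsto_intros)
    then have "\<forall>\<^sub>F k in sequentially. 2 * c\<^sup>2 * d k < e / 2"
      using \<open>e > 0\<close> by (intro order_tendstoD(2)) auto
    then obtain n0 where n0: "\<And>k. k \<ge> n0 \<Longrightarrow> 2 * c\<^sup>2 * d k < e / 2"
      unfolding eventually_sequentially by blast
    have "expectation (\<lambda>\<omega>. (norm (step_integral W (p m) \<omega> - step_integral W (p n) \<omega>))\<^sup>2) < e"
      if "m \<ge> n0" "n \<ge> n0" for m n
      using le[of m n] n0[OF that(1)] n0[OF that(2)] by (simp add: distrib_left)
    then show "\<exists>n0. \<forall>m\<ge>n0. \<forall>n\<ge>n0. expectation (\<lambda>\<omega>. (norm (step_integral W (p m) \<omega> - step_integral W (p n) \<omega>))\<^sup>2) < e"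
      by blast
  qed
  then have "\<exists>J. has_wiener_integral M W f J"
    unfolding has_wiener_integral_def using p lim by blast
  then show ?thesis
    unfolding wiener_integral_def by (rule someI_ex)
qed

text \<open>The difference of a partial sum and the limit is, in its real and in its imaginary part, a Wiener
  integral, so the isometry gives its mean square.\<close>
lemma wiener_series_converges:
  fixes e :: "nat \<Rightarrow> real \<Rightarrow> real" and a :: "nat \<Rightarrow> complex"
  assumes e: "\<And>k. square_integrable weighted01 (e k)"
    and lim: "L2_tendsto weighted01 (\<lambda>n s. \<Sum>k<n. a k * of_real (e k s)) F"
  shows "L2_tendsto M
    (\<lambda>n \<omega>. \<Sum>k<n. a k * of_real (wiener_integral M W (\<lambda>s. e k s * sqrt (weight s)) \<omega>))
    (cwiener_integral M W (\<lambda>s. F s * of_real (sqrt (weight s))))"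
proof -
  define B where "B k = wiener_integral M W (\<lambda>s. e k s * sqrt (weight s))" for k
  define R where "R = wiener_integral M W (\<lambda>s. Re (F s) * sqrt (weight s))"
  define I where "I = wiener_integral M W (\<lambda>s. Im (F s) * sqrt (weight s))"
  define S where "S n s = (\<Sum>k<n. a k * of_real (e k s))" for n s
  note F = L2_tendstoD(2)[OF lim]
  have B: "has_wiener_integral M W (\<lambda>s. e k s * sqrt (weight s)) (B k)" for k
    unfolding B_def by (intro has_wiener_integral_wiener_integral weighted01_mult_sqrt_weight e)
  have R: "has_wiener_integral M W (\<lambda>s. Re (F s) * sqrt (weight s)) R"
    unfolding R_def
    by (intro has_wiener_integral_wiener_integral weighted01_mult_sqrt_weight square_integrable_Re_Im F)
  have I: "has_wiener_integral M W (\<lambda>s. Im (F s) * sqrt (weight s)) I"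
    unfolding I_def
    by (intro has_wiener_integral_wiener_integral weighted01_mult_sqrt_weight square_integrable_Re_Im F)
  have isometry: "square_integrable M (\<lambda>\<omega>. (\<Sum>k<n. b k * B k \<omega>) - J \<omega>) \<and>
      expectation (\<lambda>\<omega>. ((\<Sum>k<n. b k * B k \<omega>) - J \<omega>)\<^sup>2) = c\<^sup>2 * (LINT s|weighted01. ((\<Sum>k<n. b k * e k s) - f s)\<^sup>2)"
    if J: "has_wiener_integral M W (\<lambda>s. f s * sqrt (weight s)) J" and f: "square_integrable weighted01 f"
    for b f J n
  proof -
    let ?h = "\<lambda>s. (\<Sum>k<n. b k * e k s) - f s"
    have h: "square_integrable weighted01 ?h"
      by (intro square_integrable_diff square_integrable_sum square_integrable_cmult e f)
    have "has_wiener_integral M W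
        (\<lambda>s. (\<Sum>k<n. b k * (e k s * sqrt (weight s))) - f s * sqrt (weight s)) (\<lambda>\<omega>. (\<Sum>k<n. b k * B k \<omega>) - J \<omega>)"
      by (intro has_wiener_integral_diff has_wiener_integral_sum has_wiener_integral_cmult B J)
    also have "(\<lambda>s. (\<Sum>k<n. b k * (e k s * sqrt (weight s))) - f s * sqrt (weight s)) = (\<lambda>s. ?h s * sqrt (weight s))"
      by (simp add: left_diff_distrib sum_distrib_right mult.assoc)
    finally have "has_wiener_integral M W (\<lambda>s. ?h s * sqrt (weight s)) (\<lambda>\<omega>. (\<Sum>k<n. b k * B k \<omega>) - J \<omega>)" .
    from has_wiener_integral_square_integrable[OF this] wiener_isometry[OF this] weighted01_mult_sqrt_weight(2)[OF h]
    show ?thesis by simp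
  qed
  note isoR = isometry[OF R square_integrable_Re_Im(1)[OF F]]
  note isoI = isometry[OF I square_integrable_Re_Im(2)[OF F]]
  have cI: "cwiener_integral M W (\<lambda>s. F s * of_real (sqrt (weight s))) = (\<lambda>\<omega>. of_real (R \<omega>) + \<i> * of_real (I \<omega>))"
    by (simp add: cwiener_integral_def[abs_def] R_def I_def)
  have "L2_tendsto M (\<lambda>n \<omega>. \<Sum>k<n. a k * of_real (B k \<omega>)) (\<lambda>\<omega>. of_real (R \<omega>) + \<i> * of_real (I \<omega>))"
  proof (rule L2_tendstoI)
    show "square_integrable M (\<lambda>\<omega>. \<Sum>k<n. a k * of_real (B k \<omega>))" for n
      by (intro square_integrable_sum square_integrable_cmult square_integrable_of_real
          has_wiener_integral_square_integrable[OF B])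
    show "square_integrable M (\<lambda>\<omega>. of_real (R \<omega>) + \<i> * of_real (I \<omega>) :: complex)"
      by (intro square_integrable_add square_integrable_cmult square_integrable_of_real
          has_wiener_integral_square_integrable[OF R] has_wiener_integral_square_integrable[OF I])
    have "(LINT \<omega>|M. (norm ((\<Sum>k<n. a k * of_real (B k \<omega>)) - (of_real (R \<omega>) + \<i> * of_real (I \<omega>))))\<^sup>2) =
        c\<^sup>2 * (LINT s|weighted01. (norm (S n s - F s))\<^sup>2)" for n
    proof -
      have "(LINT \<omega>|M. (norm ((\<Sum>k<n. a k * of_real (B k \<omega>)) - (of_real (R \<omega>) + \<i> * of_real (I \<omega>))))\<^sup>2) =
          (LINT \<omega>|M. ((\<Sum>k<n. Re (a k) * B k \<omega>) - R \<omega>)\<^sup>2 + ((\<Sum>k<n. Im (a k) * B k \<omega>) - I \<omega>)\<^sup>2)"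
        by (simp add: cmod_power2)
      also have "\<dots> = (LINT \<omega>|M. ((\<Sum>k<n. Re (a k) * B k \<omega>) - R \<omega>)\<^sup>2) + (LINT \<omega>|M. ((\<Sum>k<n. Im (a k) * B k \<omega>) - I \<omega>)\<^sup>2)"
        by (intro Bochner_Integration.integral_add square_integrable_realD conjunct1[OF isoR] conjunct1[OF isoI])
      also have "\<dots> = c\<^sup>2 * ((LINT s|weighted01. ((\<Sum>k<n. Re (a k) * e k s) - Re (F s))\<^sup>2) +
          (LINT s|weighted01. ((\<Sum>k<n. Im (a k) * e k s) - Im (F s))\<^sup>2))"
        using isoR[of "\<lambda>k. Re (a k)" n] isoI[of "\<lambda>k. Im (a k)" n] by (simp add: distrib_left)
      also have "\<dots> = c\<^sup>2 * (LINT s|weighted01. ((\<Sum>k<n. Re (a k) * e k s) - Re (F s))\<^sup>2 + ((\<Sum>k<n. Im (a k) * e k s) - Im (F s))\<^sup>2)"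
        by (subst Bochner_Integration.integral_add)
           (intro square_integrable_realD square_integrable_diff square_integrable_sum square_integrable_cmult
              e square_integrable_Re_Im F refl)+
      also have "\<dots> = c\<^sup>2 * (LINT s|weighted01. (norm (S n s - F s))\<^sup>2)"
        by (simp add: cmod_power2 S_def)
      finally show ?thesis .
    qed
    moreover have "(\<lambda>n. c\<^sup>2 * (LINT s|weighted01. (norm (S n s - F s))\<^sup>2)) \<longlonglongrightarrow> c\<^sup>2 * 0"
      using L2_tendstoD(3)[OF lim] unfolding S_def by (intro tendsto_mult_left)
    ultimately show "(\<lambda>n. LINT \<omega>|M. (norm ((\<Sum>k<n. a k * of_real (B k \<omega>)) - (of_real (R \<omega>) + \<i> * of_real (I \<omega>))))\<^sup>2) \<longlonglongrightarrow> 0"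
      by simp
  qed
  then show ?thesis unfolding cI B_def .
qed

end


section \<open>The stochastic Hermite series\<close>

theorem theorem3:
  fixes M :: "'a measure" and W :: "real \<Rightarrow> 'a \<Rightarrow> real" and c \<alpha> t :: real
    and g :: "real \<Rightarrow> complex"
  assumes "\<alpha> > 0"
    and "wiener_process M W c"
    and "square_integrable weighted01 g"
    and "t \<in> {0<..<1}"
  shows "L2_tendsto weighted01
           (\<lambda>N s. \<Sum>k<N. of_real (1 / sqrt \<alpha>) * hermite_coeff \<alpha> g k *
                     of_real (trans_hermite_fun \<alpha> k s) * hermite_eigenvalue k *
                     of_real (hermite_fun k (phi t / \<alpha>)))
           (fourier_kernel \<alpha> g t) \<and>
         L2_tendsto M
           (\<lambda>N \<omega>. \<Sum>n<N. hermite_coeff \<alpha> g n * of_real (hermite_wiener_coeff M W \<alpha> n \<omega>) *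
                     of_real (1 / sqrt \<alpha>) * hermite_eigenvalue n *
                     of_real (hermite_fun n (phi t / \<alpha>)))
           (cwiener_integral M W (\<lambda>s. fourier_kernel \<alpha> g t s * of_real (sqrt (weight s))))"
proof -
  interpret wiener_process M W c by fact
  define a where "a k = hermite_coeff \<alpha> g k * fourier_trans_hermite_fun \<alpha> k t" for k
  have kernel_terms: "of_real (1 / sqrt \<alpha>) * hermite_coeff \<alpha> g k * of_real (trans_hermite_fun \<alpha> k s) *
      hermite_eigenvalue k * of_real (hermite_fun k (phi t / \<alpha>)) = a k * of_real (trans_hermite_fun \<alpha> k s)" for k s
    by (simp add: a_def fourier_trans_hermite_fun_def ac_simps)
  have stochastic_terms: "hermite_coeff \<alpha> g k * of_real (hermite_wiener_coeff M W \<alpha> k \<omega>) * of_real (1 / sqrt \<alpha>) *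
      hermite_eigenvalue k * of_real (hermite_fun k (phi t / \<alpha>)) =
      a k * of_real (wiener_integral M W (\<lambda>s. trans_hermite_fun \<alpha> k s * sqrt (weight s)) \<omega>)" for k \<omega>
    by (simp add: a_def fourier_trans_hermite_fun_def hermite_wiener_coeff_def ac_simps)
  have "fourier_kernel_partial \<alpha> g t = (\<lambda>n s. \<Sum>k<n. a k * of_real (trans_hermite_fun \<alpha> k s))"
    by (simp add: fourier_kernel_partial_def[abs_def] a_def ac_simps)
  with fourier_kernel_converges[OF assms(1,3), of t]
  have kernel: "L2_tendsto weighted01 (\<lambda>n s. \<Sum>k<n. a k * of_real (trans_hermite_fun \<alpha> k s)) (fourier_kernel \<alpha> g t)"
    by simp
  show ?thesis
    unfolding kernel_terms stochastic_terms
    using kernel wiener_series_converges[OF orthonormalD(1)[OF trans_hermite_orthonormal[OF assms(1)]] kernel]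
    by blast
qed

end
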